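(* Let $\mathscr{X}_0\subseteq X^{\odot\star}$ be an admissible range for $\{T_0(t)\}_{t\ge0}$, let $L:X\to X^{\odot\star}$ be a bounded linear operator taking its values in $\mathscr{X}_0$, and let $\{T(t)\}_{t\ge0}$ be the $\mathcal{C}_0$-semigroup on $X$ obtained from $\{T_0(t)\}_{t\ge0}$ by perturbation with $L$. Then the maximal admissible ranges for $\{T(t)\}_{t\ge0}$ and $\{T_0(t)\}_{t\ge0}$ coincide: $X^{\odot\times}=X_0^{\odot\times}$.
   Context: All intervals are non-degenerate but otherwise arbitrary. For a Banach space $E$, $\langle x,x^\star\rangle:=x^\star(x)$ for $x\in E$, $x^\star\in E^\star$. Let $\{T_0(t)\}_{t\ge 0}$ be a $\mathcal{C}_0$-semigroup of bounded linear operators with generator $A_0$ on a Banach space $X$ over $\mathbb{K}\in\{\mathbb{R},\mathbb{C}\}$. The sun dual is $X^\odot:=\{x^\star\in X^\star: \lim_{t\downarrow 0}\|T_0(t)^\star x^\star-x^\star\|=0\}$, a norm-closed subspace of $X^\star$ invariant under all $T_0(t)^\star$; $T_0^\odot(t)$ is the restriction of $T_0(t)^\star$ to $X^\odot$ (a $\mathcal{C}_0$-semigroup with generator $A_0^\odot$); $X^{\odot\star}:=(X^\odot)^\star$, $T_0^{\odot\star}(t):=(T_0^\odot(t))^\star$, $A_0^{\odot\star}:=(A_0^\odot)^\star$. The canonical embedding $j:X\to X^{\odot\star}$ is $\langle x^\odot,jx\rangle:=\langle x,x^\odot\rangle$; it is injective with norm-closed range $jX$. It is not assumed that $X$ is sun-reflexive.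 A closed subspace $\mathscr{X}_0$ of $X^{\odot\star}$ is an admissible range for $\{T_0(t)\}$ if, for some (equivalently, for every) interval $J$, for every norm-continuous $f:J\to\mathscr{X}_0$ and all $s\le t$ in $J$ the weak$^\star$ integral $\int_s^tT_0^{\odot\star}(t-\tau)f(\tau)\,d\tau$ belongs to $jX$ (where $\langle x^\odot,\int_s^tq(\tau)d\tau\rangle:=\int_s^t\langle x^\odot,q(\tau)\rangle d\tau$ for $x^\odot\in X^\odot$); likewise for $\{T(t)\}$. The perturbed semigroup: for $L:X\to\mathscr{X}_0$ bounded linear there is a unique $\mathcal{C}_0$-semigroup $\{T(t)\}_{t\ge0}$ on $X$, with generator denoted $A$, such that $T(t)x=T_0(t)x+j^{-1}\int_0^tT_0^{\odot\star}(t-\tau)LT(\tau)x\,d\tau$ for all $x\in X$, $t\ge0$. The sun duals of $X$ with respect to $\{T_0(t)\}$ and $\{T(t)\}$ coincide, so $T^{\odot\star}(t)$ and $A^{\odot\star}$ act in the same space $X^{\odot\star}$ and $j$ is the same map. Define $X_0^{\odot\times}:=\{x^{\odot\star}\in X^{\odot\star}: R(\lambda,A_0^{\odot\star})x^{\odot\star}\in jX\}$ for $\lambda\in\rho(A_0)$ and $X^{\odot\times}:=\{x^{\odot\star}\in X^{\odot\star}: R(\lambda,A^{\odot\star})x^{\odot\star}\in jX\}$ for $\lambda\in\rho(A)$, with $R(\lambda,\cdot)$ the resolvent; these closed subspaces do not depend on the choice of $\lambda$. They are the maximal (largest with respect to inclusion) admissible ranges for $\{T_0(t)\}$ and $\{T(t)\}$,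 respectively. *)

theory Defs
  imports "HOL-Analysis.Analysis" "HOL-Library.Function_Algebras"
begin

text \<open>
  The scalar field is a type \<open>'k\<close> of sort \<open>{real_normed_field, euclidean_space}\<close>.
  Both \<open>real\<close> and \<open>complex\<close> are instances, and by Frobenius' theorem every instance is a copy of
  one of them, so this sort renders \<open>\<bbbK> \<in> {\<real>, \<complex>}\<close>. A Banach space over \<open>'k\<close> is a type of class
  \<open>banach\<close> with a compatible scalar multiplication by \<open>'k\<close>.
\<close>

locale banach_space_over = vector_space sc
  for sc :: "'k::{real_normed_field,euclidean_space} \<Rightarrow> 'a::banach \<Rightarrow> 'a" +
  assumes scale_of_real: "sc (of_real r) x = r *\<^sub>R x"
    and norm_scale: "norm (sc c x) = norm c * norm x"

lemma banach_space_over_scaleR: "banach_space_over (scaleR :: real \<Rightarrow> 'a::banach \<Rightarrow> 'a)"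
  by unfold_locales (simp_all add: algebra_simps)

lemma banach_space_over_mult_complex: "banach_space_over ((*) :: complex \<Rightarrow> complex \<Rightarrow> complex)"
  by unfold_locales (simp_all add: algebra_simps norm_mult scaleR_conv_of_real)


section \<open>Semigroups, generators and resolvents\<close>

text \<open>Only the values \<open>T t\<close> with \<open>t \<ge> 0\<close> matter.\<close>

definition c0_semigroup ::
  "('k::{real_normed_field,euclidean_space} \<Rightarrow> 'a::banach \<Rightarrow> 'a) \<Rightarrow> (real \<Rightarrow> 'a \<Rightarrow>\<^sub>L 'a) \<Rightarrow> bool"
  where "c0_semigroup sc T \<longleftrightarrow>
    (\<forall>t\<ge>0. \<forall>c x. T t (sc c x) = sc c (T t x)) \<and>
    T 0 = id_blinfun \<and>
    (\<forall>s\<ge>0. \<forall>t\<ge>0. T (s + t) = T s o\<^sub>L T t) \<and>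
    (\<forall>x. ((\<lambda>t. T t x) \<longlongrightarrow> x) (at_right 0))"

text \<open>Unbounded operators are represented by their graphs.\<close>

definition generator :: "'v::real_normed_vector set \<Rightarrow> (real \<Rightarrow> 'v \<Rightarrow> 'v) \<Rightarrow> ('v \<times> 'v) set"
  where "generator S T =
    {(x, y). x \<in> S \<and> y \<in> S \<and> ((\<lambda>h. (T h x - x) /\<^sub>R h) \<longlongrightarrow> y) (at_right 0)}"

definition resolvent :: "('k \<Rightarrow> 'v \<Rightarrow> 'v::minus) \<Rightarrow> 'k \<Rightarrow> ('v \<times> 'v) set \<Rightarrow> 'v \<Rightarrow> 'v"
  where "resolvent sc \<mu> A y = (THE x. \<exists>z. (x, z) \<in> A \<and> sc \<mu> x - z = y)"

definition resolvent_set :: "('k \<Rightarrow> 'a::real_normed_vector \<Rightarrow> 'a) \<Rightarrow> ('a \<times> 'a) set \<Rightarrow> 'k set"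
  where "resolvent_set sc A =
    {\<mu>. (\<forall>y. \<exists>!x. \<exists>z. (x, z) \<in> A \<and> sc \<mu> x - z = y) \<and> bounded_linear (resolvent sc \<mu> A)}"


section \<open>Dual spaces\<close>

text \<open>
  Blinfuns are merely real-linear, so the dual over \<open>'k\<close> consists of the \<open>'k\<close>-linear ones. Its norm
  is that of the type \<open>'a \<Rightarrow>\<^sub>L 'k\<close>.
\<close>

definition dual_space ::
  "('k::{real_normed_field,euclidean_space} \<Rightarrow> 'a::banach \<Rightarrow> 'a) \<Rightarrow> ('a \<Rightarrow>\<^sub>L 'k) set"
  where "dual_space sc = {f. \<forall>c x. blinfun_apply f (sc c x) = c * blinfun_apply f x}"

definition scale_dual :: "'k::{real_normed_field,euclidean_space} \<Rightarrow> ('a::banach \<Rightarrow>\<^sub>L 'k) \<Rightarrow> ('a \<Rightarrow>\<^sub>L 'k)"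
  where "scale_dual c f = blinfun_mult_right c o\<^sub>L f"

text \<open>
  The dual of a subspace \<open>S\<close> of the dual space of \<open>'a\<close>. Functionals on \<open>S\<close> are functions that vanish
  outside \<open>S\<close>, so that equality of functions is equality on \<open>S\<close>; addition and
  subtraction are pointwise.
\<close>

definition dual_of :: "('a::banach \<Rightarrow>\<^sub>L 'k::{real_normed_field,euclidean_space}) set
    \<Rightarrow> (('a \<Rightarrow>\<^sub>L 'k) \<Rightarrow> 'k) set"
  where "dual_of S = {\<phi>.
    (\<forall>f\<in>S. \<forall>g\<in>S. \<phi> (f + g) = \<phi> f + \<phi> g) \<and>
    (\<forall>c. \<forall>f\<in>S. \<phi> (scale_dual c f) = c * \<phi> f) \<and>
    (\<exists>C. \<forall>f\<in>S. norm (\<phi> f) \<le> C * norm f) \<and>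
    (\<forall>f. f \<notin> S \<longrightarrow> \<phi> f = 0)}"

definition scale_fun :: "'k::times \<Rightarrow> ('v \<Rightarrow> 'k) \<Rightarrow> 'v \<Rightarrow> 'k"
  where "scale_fun c \<phi> = (\<lambda>f. c * \<phi> f)"

definition dual_norm :: "'v::real_normed_vector set \<Rightarrow> ('v \<Rightarrow> 'k::real_normed_vector) \<Rightarrow> real"
  where "dual_norm S \<phi> = (SUP f\<in>{f \<in> S. norm f \<le> 1}. norm (\<phi> f))"

definition closed_subspace_dual :: "('a::banach \<Rightarrow>\<^sub>L 'k::{real_normed_field,euclidean_space}) set
    \<Rightarrow> (('a \<Rightarrow>\<^sub>L 'k) \<Rightarrow> 'k) set \<Rightarrow> bool"
  where "closed_subspace_dual S M \<longleftrightarrow>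
    M \<subseteq> dual_of S \<and> 0 \<in> M \<and>
    (\<forall>\<phi>\<in>M. \<forall>\<psi>\<in>M. \<phi> + \<psi> \<in> M) \<and>
    (\<forall>c. \<forall>\<phi>\<in>M. scale_fun c \<phi> \<in> M) \<and>
    (\<forall>u. \<forall>\<phi>\<in>dual_of S.
      (\<forall>n. u n \<in> M) \<and> (\<lambda>n. dual_norm S (u n - \<phi>)) \<longlonglongrightarrow> 0 \<longrightarrow> \<phi> \<in> M)"

definition norm_continuous_on :: "('a::banach \<Rightarrow>\<^sub>L 'k::{real_normed_field,euclidean_space}) set
    \<Rightarrow> real set \<Rightarrow> (real \<Rightarrow> ('a \<Rightarrow>\<^sub>L 'k) \<Rightarrow> 'k) \<Rightarrow> bool"
  where "norm_continuous_on S J q \<longleftrightarrow>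
    (\<forall>t\<in>J. ((\<lambda>s. dual_norm S (q s - q t)) \<longlongrightarrow> 0) (at t within J))"

definition weakstar_integral :: "('a::banach \<Rightarrow>\<^sub>L 'k::{real_normed_field,euclidean_space}) set
    \<Rightarrow> real \<Rightarrow> real \<Rightarrow> (real \<Rightarrow> ('a \<Rightarrow>\<^sub>L 'k) \<Rightarrow> 'k) \<Rightarrow> ('a \<Rightarrow>\<^sub>L 'k) \<Rightarrow> 'k"
  where "weakstar_integral S a b q = (\<lambda>f. if f \<in> S then integral {a..b} (\<lambda>\<tau>. q \<tau> f) else 0)"

text \<open>The adjoint, acting in \<open>dual_of S\<close>, of an operator with graph \<open>B\<close> densely defined in \<open>S\<close>.\<close>

definition adjoint_graph :: "('a::banach \<Rightarrow>\<^sub>L 'k::{real_normed_field,euclidean_space}) set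
    \<Rightarrow> (('a \<Rightarrow>\<^sub>L 'k) \<times> ('a \<Rightarrow>\<^sub>L 'k)) set \<Rightarrow> ((('a \<Rightarrow>\<^sub>L 'k) \<Rightarrow> 'k) \<times> (('a \<Rightarrow>\<^sub>L 'k) \<Rightarrow> 'k)) set"
  where "adjoint_graph S B =
    {(\<phi>, \<psi>). \<phi> \<in> dual_of S \<and> \<psi> \<in> dual_of S \<and> (\<forall>(f, g)\<in>B. \<psi> f = \<phi> g)}"


section \<open>Sun duality\<close>

definition adjoint_semigroup :: "(real \<Rightarrow> 'a::banach \<Rightarrow>\<^sub>L 'a) \<Rightarrow> real
    \<Rightarrow> ('a \<Rightarrow>\<^sub>L 'k::{real_normed_field,euclidean_space}) \<Rightarrow> ('a \<Rightarrow>\<^sub>L 'k)"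
  where "adjoint_semigroup T t f = f o\<^sub>L T t"

definition sun_dual :: "('k::{real_normed_field,euclidean_space} \<Rightarrow> 'a::banach \<Rightarrow> 'a)
    \<Rightarrow> (real \<Rightarrow> 'a \<Rightarrow>\<^sub>L 'a) \<Rightarrow> ('a \<Rightarrow>\<^sub>L 'k) set"
  where "sun_dual sc T =
    {f \<in> dual_space sc. ((\<lambda>t. norm (adjoint_semigroup T t f - f)) \<longlongrightarrow> 0) (at_right 0)}"

definition sun_star_dual :: "('k::{real_normed_field,euclidean_space} \<Rightarrow> 'a::banach \<Rightarrow> 'a)
    \<Rightarrow> (real \<Rightarrow> 'a \<Rightarrow>\<^sub>L 'a) \<Rightarrow> (('a \<Rightarrow>\<^sub>L 'k) \<Rightarrow> 'k) set"
  where "sun_star_dual sc T = dual_of (sun_dual sc T)"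

definition sun_star_semigroup :: "('k::{real_normed_field,euclidean_space} \<Rightarrow> 'a::banach \<Rightarrow> 'a)
    \<Rightarrow> (real \<Rightarrow> 'a \<Rightarrow>\<^sub>L 'a) \<Rightarrow> real \<Rightarrow> (('a \<Rightarrow>\<^sub>L 'k) \<Rightarrow> 'k) \<Rightarrow> ('a \<Rightarrow>\<^sub>L 'k) \<Rightarrow> 'k"
  where "sun_star_semigroup sc T t \<phi> =
    (\<lambda>f. if f \<in> sun_dual sc T then \<phi> (adjoint_semigroup T t f) else 0)"

definition sun_generator :: "('k::{real_normed_field,euclidean_space} \<Rightarrow> 'a::banach \<Rightarrow> 'a)
    \<Rightarrow> (real \<Rightarrow> 'a \<Rightarrow>\<^sub>L 'a) \<Rightarrow> (('a \<Rightarrow>\<^sub>L 'k) \<times> ('a \<Rightarrow>\<^sub>L 'k)) set"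
  where "sun_generator sc T = generator (sun_dual sc T) (adjoint_semigroup T)"

definition sun_star_generator :: "('k::{real_normed_field,euclidean_space} \<Rightarrow> 'a::banach \<Rightarrow> 'a)
    \<Rightarrow> (real \<Rightarrow> 'a \<Rightarrow>\<^sub>L 'a) \<Rightarrow> ((('a \<Rightarrow>\<^sub>L 'k) \<Rightarrow> 'k) \<times> (('a \<Rightarrow>\<^sub>L 'k) \<Rightarrow> 'k)) set"
  where "sun_star_generator sc T = adjoint_graph (sun_dual sc T) (sun_generator sc T)"

definition sun_embedding :: "('k::{real_normed_field,euclidean_space} \<Rightarrow> 'a::banach \<Rightarrow> 'a)
    \<Rightarrow> (real \<Rightarrow> 'a \<Rightarrow>\<^sub>L 'a) \<Rightarrow> 'a \<Rightarrow> ('a \<Rightarrow>\<^sub>L 'k) \<Rightarrow> 'k"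
  where "sun_embedding sc T x = (\<lambda>f. if f \<in> sun_dual sc T then f x else 0)"


section \<open>Admissible ranges and perturbed semigroups\<close>

definition admissible_range :: "('k::{real_normed_field,euclidean_space} \<Rightarrow> 'a::banach \<Rightarrow> 'a)
    \<Rightarrow> (real \<Rightarrow> 'a \<Rightarrow>\<^sub>L 'a) \<Rightarrow> (('a \<Rightarrow>\<^sub>L 'k) \<Rightarrow> 'k) set \<Rightarrow> bool"
  where "admissible_range sc T M \<longleftrightarrow>
    closed_subspace_dual (sun_dual sc T) M \<and>
    (\<exists>J. is_interval J \<and> (\<exists>a\<in>J. \<exists>b\<in>J. a < b) \<and>
      (\<forall>q. (\<forall>t\<in>J. q t \<in> M) \<and> norm_continuous_on (sun_dual sc T) J q \<longrightarrow>
        (\<forall>s\<in>J. \<forall>t\<in>J. s \<le> t \<longrightarrow>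
          weakstar_integral (sun_dual sc T) s t (\<lambda>\<tau>. sun_star_semigroup sc T (t - \<tau>) (q \<tau>))
            \<in> range (sun_embedding sc T))))"

definition maximal_admissible_range :: "('k::{real_normed_field,euclidean_space} \<Rightarrow> 'a::banach \<Rightarrow> 'a)
    \<Rightarrow> (real \<Rightarrow> 'a \<Rightarrow>\<^sub>L 'a) \<Rightarrow> (('a \<Rightarrow>\<^sub>L 'k) \<Rightarrow> 'k) set \<Rightarrow> bool"
  where "maximal_admissible_range sc T M \<longleftrightarrow>
    admissible_range sc T M \<and> (\<forall>N. admissible_range sc T N \<longrightarrow> N \<subseteq> M)"

text \<open>
  The space \<open>X\<^sup>\<odot>\<^sup>\<times>\<close>, computed with the resolvent at \<open>\<mu>\<close>. It is meaningful for \<open>\<mu>\<close> in the resolvent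
  set of the generator of \<open>T\<close> on \<open>'a\<close>, which equals that of \<open>sun_star_generator sc T\<close>.
\<close>

definition sun_times :: "('k::{real_normed_field,euclidean_space} \<Rightarrow> 'a::banach \<Rightarrow> 'a)
    \<Rightarrow> (real \<Rightarrow> 'a \<Rightarrow>\<^sub>L 'a) \<Rightarrow> 'k \<Rightarrow> (('a \<Rightarrow>\<^sub>L 'k) \<Rightarrow> 'k) set"
  where "sun_times sc T \<mu> =
    {\<phi> \<in> sun_star_dual sc T.
      resolvent scale_fun \<mu> (sun_star_generator sc T) \<phi> \<in> range (sun_embedding sc T)}"

definition bounded_linear_sun_star :: "('k::{real_normed_field,euclidean_space} \<Rightarrow> 'a::banach \<Rightarrow> 'a)
    \<Rightarrow> (real \<Rightarrow> 'a \<Rightarrow>\<^sub>L 'a) \<Rightarrow> ('a \<Rightarrow> ('a \<Rightarrow>\<^sub>L 'k) \<Rightarrow> 'k) \<Rightarrow> bool"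
  where "bounded_linear_sun_star sc T L \<longleftrightarrow>
    range L \<subseteq> sun_star_dual sc T \<and>
    (\<forall>x y. L (x + y) = L x + L y) \<and>
    (\<forall>c x. L (sc c x) = scale_fun c (L x)) \<and>
    (\<exists>C. \<forall>x. dual_norm (sun_dual sc T) (L x) \<le> C * norm x)"

definition perturbed_semigroup :: "('k::{real_normed_field,euclidean_space} \<Rightarrow> 'a::banach \<Rightarrow> 'a)
    \<Rightarrow> (real \<Rightarrow> 'a \<Rightarrow>\<^sub>L 'a) \<Rightarrow> ('a \<Rightarrow> ('a \<Rightarrow>\<^sub>L 'k) \<Rightarrow> 'k) \<Rightarrow> (real \<Rightarrow> 'a \<Rightarrow>\<^sub>L 'a) \<Rightarrow> bool"
  where "perturbed_semigroup sc T0 L T \<longleftrightarrow>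
    c0_semigroup sc T \<and>
    (\<forall>x. \<forall>t\<ge>0. T t x = T0 t x +
      inv (sun_embedding sc T0)
        (weakstar_integral (sun_dual sc T0) 0 t
          (\<lambda>\<tau>. sun_star_semigroup sc T0 (t - \<tau>) (L (T \<tau> x)))))"

end

theory Submission
  imports Defs
begin

text \<open>
  Write \<open>S\<close> for the sun dual and \<open>j\<close> for the embedding of \<open>X\<close> into the dual of \<open>S\<close>. The idea is to describe the
  maximal admissible range in a form that involves no resolvent and that visibly survives the
  perturbation: it is the set \<open>sun_cross\<close> of all \<open>\<phi>\<close> in the dual of \<open>S\<close> of the form \<open>\<phi> = j y - \<psi>\<close>, where
  \<open>\<psi>\<close> is the weak-star derivative at \<open>0\<close> of the orbit \<open>t \<mapsto> j (T t x)\<close> for some \<open>x\<close>. In other words, it is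
  the sum of \<open>j X\<close> and the image of \<open>j X\<close> under the weak-star generator.

  Three facts carry the proof.

  First, \<open>\<phi>\<close> belongs to \<open>sun_cross\<close> exactly if the weak-star integrals of its orbit
  under the sun-star semigroup over \<open>{0..t}\<close> lie in
  \<open>j X\<close> for all small \<open>t\<close> (\<open>sun_cross_integral\<close>, \<open>sun_crossI\<close>). Since \<open>j X\<close> is norm closed, a closed subspace
  is therefore an admissible range if and only if it is contained in \<open>sun_cross\<close>
  (\<open>admissible_range_iff\<close>): constant functions give one direction, approximation by step functions
  the other. The same description identifies \<open>sun_cross\<close> with the space defined by the resolvent at
  any \<open>\<mu>\<close> in the resolvent set (\<open>sun_times_eq_sun_cross\<close>).

  Second, the integral equation for the perturbed semigroup \<open>T\<close> shows that \<open>T t - T0 t\<close> has operator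
  norm \<open>O(t)\<close>, so the two sun duals coincide (\<open>sun_dual_eq\<close>), and that the weak-star derivative at \<open>0\<close> of
  \<open>j (T t x) - j (T0 t x)\<close> is \<open>L x\<close> for every \<open>x\<close> (\<open>weakstar_derivative_difference\<close>). Hence passing from
  \<open>T0\<close> to \<open>T\<close> changes the representation \<open>\<phi> = j y - \<psi>\<close> only by the term \<open>L x\<close>, and the two sets
  \<open>sun_cross\<close> agree as soon as each of them contains the range of \<open>L\<close>
  (\<open>sun_cross_subset_perturbed\<close>).

  Third, both do contain it. For \<open>T0\<close> this is the admissibility hypothesis. For \<open>T\<close> it is immediate
  for \<open>L z\<close> with \<open>z\<close> in the domain of the generator of \<open>T0\<close>, because then the orbits of \<open>z\<close> under both
  semigroups are weak-star differentiable; the general case follows by density of that domain and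
  closedness of \<open>j X\<close> (\<open>L_in_sun_cross_T\<close>).

  Closedness of \<open>j X\<close> rests on the fact that \<open>S\<close> norms \<open>X\<close> up to a constant, hence on the Hahn-Banach
  theorem; local boundedness of the semigroups rests on the uniform boundedness principle. Both are
  derived at the beginning.
\<close>


section \<open>Norming functionals\<close>

definition sublinear :: "('a::real_normed_vector \<Rightarrow> real) \<Rightarrow> bool"
  where "sublinear q \<longleftrightarrow> (\<forall>x y. q (x + y) \<le> q x + q y) \<and> (\<forall>c\<ge>0. \<forall>x. q (c *\<^sub>R x) = c * q x)"

lemma sublinearD:
  assumes "sublinear q"
  shows "q (x + y) \<le> q x + q y" "c \<ge> 0 \<Longrightarrow> q (c *\<^sub>R x) = c * q x" "q 0 = 0" "- q (- x) \<le> q x"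
proof -
  show 1: "q (x + y) \<le> q x + q y" for x y using assms unfolding sublinear_def by blast
  show 2: "c \<ge> 0 \<Longrightarrow> q (c *\<^sub>R x) = c * q x" for c x using assms unfolding sublinear_def by blast
  show 3: "q 0 = 0" using 2[of 0 0] by simp
  show "- q (- x) \<le> q x" using 1[of x "- x"] 3 by simp
qed

lemma sublinear_norm: "sublinear norm"
  by (auto simp: sublinear_def norm_triangle_ineq)

text \<open>
  The sublinear functional obtained from \<open>q\<close> by making it as linear as possible in the direction \<open>y\<close>:
  it stays below \<open>q\<close>, and its value at \<open>- y\<close> is at most \<open>- q y\<close>. It serves twice, to start
  the Hahn-Banach argument at a given vector and to show that minimal sublinear functionals are linear.
\<close>

definition lower_towards :: "('a::real_normed_vector \<Rightarrow> real) \<Rightarrow> 'a \<Rightarrow> 'a \<Rightarrow> real"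
  where "lower_towards q y x = (INF t\<in>{0..}. q (x + t *\<^sub>R y) - t * q y)"

context
  fixes q :: "'a::real_normed_vector \<Rightarrow> real" and y :: 'a
  assumes q: "sublinear q"
begin

lemma lower_towards_bdd: "bdd_below ((\<lambda>t. q (x + t *\<^sub>R y) - t * q y) ` {0..})"
proof (rule bdd_belowI2[where m = "- q (- x)"])
  fix t :: real assume "t \<in> {0..}"
  then have "t * q y = q ((x + t *\<^sub>R y) + - x)" using sublinearD(2)[OF q] by simp
  also have "\<dots> \<le> q (x + t *\<^sub>R y) + q (- x)" by (rule sublinearD(1)[OF q])
  finally show "- q (- x) \<le> q (x + t *\<^sub>R y) - t * q y" by simp
qed

lemma lower_towards_le: "t \<ge> 0 \<Longrightarrow> lower_towards q y x \<le> q (x + t *\<^sub>R y) - t * q y"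
  unfolding lower_towards_def by (rule cINF_lower[OF lower_towards_bdd]) simp

lemma lower_towards_le_self: "lower_towards q y x \<le> q x"
  using lower_towards_le[of 0 x] by simp

lemma lower_towards_greatest:
  "(\<And>t. t \<ge> 0 \<Longrightarrow> m \<le> q (x + t *\<^sub>R y) - t * q y) \<Longrightarrow> m \<le> lower_towards q y x"
  unfolding lower_towards_def by (rule cINF_greatest) auto

lemma sublinear_lower_towards: "sublinear (lower_towards q y)"
proof -
  have add: "lower_towards q y (u + v) \<le> lower_towards q y u + lower_towards q y v" for u v
  proof -
    have "lower_towards q y (u + v) - (q (u + s *\<^sub>R y) - s * q y) \<le> q (v + t *\<^sub>R y) - t * q y"
      if "s \<ge> 0" "t \<ge> 0" for s t
    proof -
      have "lower_towards q y (u + v) \<le> q ((u + s *\<^sub>R y) + (v + t *\<^sub>R y)) - (s + t) * q y"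
        using lower_towards_le[of "s + t" "u + v"] that by (simp add: algebra_simps)
      then show ?thesis
        using sublinearD(1)[OF q, of "u + s *\<^sub>R y" "v + t *\<^sub>R y"] by (simp add: algebra_simps)
    qed
    then have "lower_towards q y (u + v) - (q (u + s *\<^sub>R y) - s * q y) \<le> lower_towards q y v"
      if "s \<ge> 0" for s using that by (intro lower_towards_greatest)
    then have "lower_towards q y (u + v) - lower_towards q y v \<le> q (u + s *\<^sub>R y) - s * q y"
      if "s \<ge> 0" for s using that by (simp add: algebra_simps)
    then have "lower_towards q y (u + v) - lower_towards q y v \<le> lower_towards q y u"
      by (intro lower_towards_greatest)
    then show ?thesis by simp
  qed
  have le: "c * lower_towards q y x \<le> lower_towards q y (c *\<^sub>R x)" if "c > 0" for c x
  proof (rule lower_towards_greatest)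
    fix t :: real assume t: "t \<ge> 0"
    have "c * lower_towards q y x \<le> c * (q (x + (t / c) *\<^sub>R y) - (t / c) * q y)"
      using lower_towards_le[of "t / c" x] t that by (intro mult_left_mono) auto
    also have "\<dots> = q (c *\<^sub>R (x + (t / c) *\<^sub>R y)) - t * q y"
      using sublinearD(2)[OF q, of c "x + (t / c) *\<^sub>R y"] that by (simp add: right_diff_distrib)
    also have "\<dots> = q (c *\<^sub>R x + t *\<^sub>R y) - t * q y" using that by (simp add: scaleR_right_distrib)
    finally show "c * lower_towards q y x \<le> q (c *\<^sub>R x + t *\<^sub>R y) - t * q y" .
  qed
  have ge: "lower_towards q y (c *\<^sub>R x) \<le> c * lower_towards q y x" if "c > 0" for c x
  proof -
    have "inverse c * lower_towards q y (c *\<^sub>R x) \<le> lower_towards q y x"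
      using le[of "inverse c" "c *\<^sub>R x"] that by simp
    then show ?thesis using that by (simp add: field_simps)
  qed
  have zero: "lower_towards q y 0 = 0"
  proof (rule antisym)
    show "lower_towards q y 0 \<le> 0" using lower_towards_le_self[of 0] sublinearD(3)[OF q] by simp
    show "0 \<le> lower_towards q y 0"
      by (rule lower_towards_greatest) (simp add: sublinearD(2)[OF q])
  qed
  have "lower_towards q y (c *\<^sub>R x) = c * lower_towards q y x" if "c \<ge> 0" for c x
    using that zero le[of c x] ge[of c x] by (cases "c = 0") auto
  with add show ?thesis unfolding sublinear_def by blast
qed

end

lemma sublinear_chain_lower_bound:
  assumes ne: "C \<noteq> {}" and sub: "\<And>q. q \<in> C \<Longrightarrow> sublinear q"
    and chain: "\<And>p q. p \<in> C \<Longrightarrow> q \<in> C \<Longrightarrow> (\<forall>x. p x \<le> q x) \<or> (\<forall>x. q x \<le> p x)"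
  shows "\<exists>m. sublinear m \<and> (\<forall>q\<in>C. \<forall>x. m x \<le> q x)"
proof -
  obtain q0 where q0: "q0 \<in> C" using ne by blast
  define m where "m x = (INF q\<in>C. q x)" for x
  have lb: "- q0 (- x) \<le> q x" if "q \<in> C" for q x
  proof -
    have "- q (- x) \<le> q x" "- q0 (- x) \<le> q0 x"
      using sublinearD(4)[OF sub] that q0 by auto
    then show ?thesis using chain[OF that q0] by (smt (verit))
  qed
  have bdd: "bdd_below ((\<lambda>q. q x) ` C)" for x by (rule bdd_belowI2[OF lb])
  have le: "m x \<le> q x" if "q \<in> C" for q x
    unfolding m_def by (rule cINF_lower[OF bdd that])
  have great: "a \<le> m x" if "\<And>q. q \<in> C \<Longrightarrow> a \<le> q x" for a x
    unfolding m_def by (rule cINF_greatest[OF ne that])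
  have "m (x + y) \<le> m x + m y" for x y
  proof -
    have "m (x + y) - p x \<le> q y" if pq: "p \<in> C" "q \<in> C" for p q
    proof -
      have "\<exists>r\<in>C. \<forall>x. r x \<le> p x \<and> r x \<le> q x" using chain[OF pq] pq by auto
      then obtain r where "r \<in> C" "\<And>x. r x \<le> p x" "\<And>x. r x \<le> q x" by blast
      then show ?thesis using le[of r "x + y"] sublinearD(1)[OF sub, of r x y] by (smt (verit))
    qed
    then have h: "m (x + y) - p x \<le> m y" if "p \<in> C" for p using that by (intro great)
    have "m (x + y) - m y \<le> p x" if "p \<in> C" for p using h[OF that] by linarith
    then have "m (x + y) - m y \<le> m x" by (intro great)
    then show ?thesis by simp
  qed
  moreover have "m (c *\<^sub>R x) = c * m x" if c: "c \<ge> 0" for c x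
  proof (cases "c = 0")
    case True
    have "m 0 \<le> 0" using le[OF q0, of 0] sublinearD(3)[OF sub[OF q0]] by simp
    moreover have "0 \<le> m 0" by (rule great) (simp add: sublinearD(3)[OF sub])
    ultimately show ?thesis using True by simp
  next
    case False
    then have c: "c > 0" using c by simp
    have "m (c *\<^sub>R x) / c \<le> q x" if "q \<in> C" for q
      using le[OF that, of "c *\<^sub>R x"] sublinearD(2)[OF sub[OF that], of c x] c
      by (simp add: divide_le_eq mult.commute)
    then have "m (c *\<^sub>R x) / c \<le> m x" by (rule great)
    moreover have "c * m x \<le> m (c *\<^sub>R x)"
      using c by (intro great) (simp add: sublinearD(2)[OF sub] le)
    ultimately show ?thesis using c by (simp add: divide_le_eq mult.commute)
  qed
  ultimately show ?thesis using le unfolding sublinear_def by blast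
qed

text \<open>
  By Zorn's lemma there is a minimal sublinear functional below \<open>p\<close>. A minimal one is unchanged by
  \<open>lower_towards\<close> in every direction, hence odd, and odd sublinear functionals are linear.
  No extension of partially defined functionals is involved.
\<close>

lemma linear_below_sublinear:
  fixes p :: "'a::real_normed_vector \<Rightarrow> real"
  assumes p: "sublinear p"
  shows "\<exists>u. linear u \<and> (\<forall>x. u x \<le> p x)"
proof -
  define A where "A = {q. sublinear q \<and> (\<forall>x. q x \<le> p x)}"
  have "\<exists>m\<in>A. \<forall>q\<in>A. (\<forall>x. q x \<le> m x) \<longrightarrow> q = m"
  proof (rule predicate_Zorn)
    show "partial_order_on A (relation_of (\<lambda>m q. \<forall>x. q x \<le> m x) A)"
      by (rule partial_order_on_relation_ofI)
        (auto simp: fun_eq_iff intro: order_trans order.antisym)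
  next
    fix C assume C: "C \<in> Chains (relation_of (\<lambda>m q. \<forall>x. q x \<le> m x) A)"
    then have CA: "C \<subseteq> A" and
      ch: "\<And>f g. f \<in> C \<Longrightarrow> g \<in> C \<Longrightarrow> (\<forall>x. f x \<le> g x) \<or> (\<forall>x. g x \<le> f x)"
      unfolding Chains_def relation_of_def by blast+
    show "\<exists>u\<in>A. \<forall>a\<in>C. \<forall>x. u x \<le> a x"
    proof (cases "C = {}")
      case True
      then show ?thesis using p unfolding A_def by auto
    next
      case False
      then obtain m where "sublinear m" "\<forall>q\<in>C. \<forall>x. m x \<le> q x"
        using sublinear_chain_lower_bound[of C] CA ch unfolding A_def by blast
      moreover from this obtain q where "q \<in> C" "\<forall>x. m x \<le> q x" using False by blast
      ultimately show ?thesis using CA unfolding A_def by (blast intro: order_trans)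
    qed
  qed
  then obtain m where m: "m \<in> A" and min: "\<And>q. q \<in> A \<Longrightarrow> \<forall>x. q x \<le> m x \<Longrightarrow> q = m" by blast
  then have sm: "sublinear m" and mp: "\<And>x. m x \<le> p x" unfolding A_def by auto
  have odd: "m (- y) = - m y" for y
  proof -
    have "lower_towards m y = m"
    proof (rule min)
      show "\<forall>x. lower_towards m y x \<le> m x" using lower_towards_le_self[OF sm] by blast
      then show "lower_towards m y \<in> A"
        using sublinear_lower_towards[OF sm] mp unfolding A_def by (blast intro: order_trans)
    qed
    then have "m (- y) \<le> - m y"
      using lower_towards_le[OF sm, of 1 y "- y"] sublinearD(3)[OF sm] by simp
    then show ?thesis using sublinearD(4)[OF sm, of y] by simp
  qed
  have "m (x + y) = m x + m y" for x y
    using sublinearD(1)[OF sm, of x y] sublinearD(1)[OF sm, of "- x" "- y"] odd[of "x + y"] odd[of x] odd[of y]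
    by simp
  moreover have "m (c *\<^sub>R x) = c *\<^sub>R m x" for c x
  proof (cases "c \<ge> 0")
    case True then show ?thesis using sublinearD(2)[OF sm] by simp
  next
    case False
    then have "m ((- c) *\<^sub>R x) = - c * m x" using sublinearD(2)[OF sm, of "- c"] by simp
    then show ?thesis using odd[of "c *\<^sub>R x"] by simp
  qed
  ultimately have "linear m" by (rule linearI)
  with mp show ?thesis by blast
qed

text \<open>
  Starting from \<open>lower_towards norm x\<close>, which is at most \<open>- norm x\<close> at \<open>- x\<close>, forces equality at \<open>x\<close>.
\<close>

lemma norming_functional_real:
  fixes x :: "'a::real_normed_vector"
  shows "\<exists>u. linear u \<and> (\<forall>y. \<bar>u y\<bar> \<le> norm y) \<and> u x = norm x"
proof -
  let ?p = "lower_towards norm x"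
  obtain u where u: "linear u" and le: "\<And>y. u y \<le> ?p y"
    using linear_below_sublinear[OF sublinear_lower_towards[OF sublinear_norm]] by blast
  have n: "u y \<le> norm y" for y
    using le[of y] lower_towards_le_self[OF sublinear_norm, of x y] by simp
  have "\<bar>u y\<bar> \<le> norm y" for y
    using n[of y] n[of "- y"] linear_neg[OF u, of y] by simp
  moreover have "u x = norm x"
    using le[of "- x"] lower_towards_le[OF sublinear_norm, of 1 x "- x"] linear_neg[OF u, of x] n[of x]
    by simp
  ultimately show ?thesis using u by blast
qed

text \<open>
  The form \<open>(c, a) \<mapsto> (c * a) \<bullet> 1\<close> on the finite-dimensional field \<open>'k\<close> is nondegenerate, since
  \<open>c = inverse a\<close> gives \<open>1 \<bullet> 1\<close>. Hence every real-linear functional on \<open>'k\<close> has the form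
  \<open>c \<mapsto> (c * a) \<bullet> 1\<close>. For the complex numbers this is the passage from a functional to its real part;
  using the form instead treats all instances of the sort at once.
\<close>

lemma trace_form_represents:
  obtains r :: "('k::{real_normed_field,euclidean_space} \<Rightarrow> real) \<Rightarrow> 'k" and B :: real where
    "\<And>g c. linear g \<Longrightarrow> (c * r g) \<bullet> 1 = g c"
    "\<And>g C. linear g \<Longrightarrow> (\<And>c. \<bar>g c\<bar> \<le> C * norm c) \<Longrightarrow> norm (r g) \<le> B * C" "B > 0"
    "\<And>a b :: 'k. (\<And>c. (c * a) \<bullet> 1 = (c * b) \<bullet> 1) \<Longrightarrow> a = b"
proof -
  define P :: "'k \<Rightarrow> 'k" where "P a = (\<Sum>b\<in>Basis. ((b * a) \<bullet> 1) *\<^sub>R b)" for a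
  have linP: "linear P"
    unfolding P_def by (intro linearI)
      (simp_all add: algebra_simps inner_add_left sum.distrib scaleR_sum_right)
  have Pb: "P a \<bullet> b = (b * a) \<bullet> 1" if "b \<in> Basis" for a b
    using that unfolding P_def by (simp add: inner_sum_left inner_Basis if_distrib sum.delta cong: if_cong)
  have Pc: "c \<bullet> P a = (c * a) \<bullet> 1" for a c
  proof -
    have "c \<bullet> P a = (\<Sum>b\<in>Basis. (c \<bullet> b) * ((b * a) \<bullet> 1))"
      unfolding euclidean_inner[of c "P a"] using Pb by simp
    also have "\<dots> = ((\<Sum>b\<in>Basis. (c \<bullet> b) *\<^sub>R b) * a) \<bullet> 1"
      by (simp add: sum_distrib_right inner_sum_left)
    finally show ?thesis by (simp add: euclidean_representation)
  qed
  have ker: "a = 0" if "P a = 0" for a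
  proof (rule ccontr)
    assume "a \<noteq> 0"
    then have "inverse a \<bullet> P a = (1::'k) \<bullet> 1" by (simp add: Pc)
    with that show False by simp
  qed
  then have inj: "inj P" using linP by (simp add: linear_injective_0)
  then have surj: "surj P" using linP by (simp add: linear_injective_imp_surjective)
  have lini: "linear (inv P)" using linP inj surj by (simp add: inj_linear_imp_inv_linear)
  then obtain B where B: "B > 0" "\<And>w. norm (inv P w) \<le> B * norm w"
    using linear_bounded_pos by blast
  define w :: "('k \<Rightarrow> real) \<Rightarrow> 'k" where "w g = (\<Sum>b\<in>Basis. g b *\<^sub>R b)" for g
  have w: "c \<bullet> w g = g c" if "linear g" for g c
  proof -
    have "c \<bullet> w g = (\<Sum>b\<in>Basis. (c \<bullet> b) * g b)"
      unfolding w_def by (simp add: inner_sum_right mult.commute)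
    also have "\<dots> = g (\<Sum>b\<in>Basis. (c \<bullet> b) *\<^sub>R b)"
      using that by (simp add: linear_sum linear_scale)
    finally show ?thesis by (simp add: euclidean_representation)
  qed
  show thesis
  proof (rule that[of "\<lambda>g. inv P (w g)" B])
    fix g :: "'k \<Rightarrow> real" and c assume g: "linear g"
    have "(c * inv P (w g)) \<bullet> 1 = c \<bullet> P (inv P (w g))" by (rule Pc[symmetric])
    then show "(c * inv P (w g)) \<bullet> 1 = g c" using w[OF g] surj by (simp add: surj_f_inv_f)
  next
    fix g :: "'k \<Rightarrow> real" and C assume g: "linear g" and C: "\<And>c. \<bar>g c\<bar> \<le> C * norm c"
    have "norm (w g) * norm (w g) = \<bar>g (w g)\<bar>" by (simp flip: w[OF g] power2_norm_eq_inner power2_eq_square)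
    also have "\<dots> \<le> C * norm (w g)" by (rule C)
    finally have "norm (w g) \<le> C \<or> w g = 0"
      by (metis mult_le_cancel_right norm_ge_zero norm_le_zero_iff not_le)
    moreover have "C \<ge> 0" using C[of 1] abs_ge_zero[of "g 1"] by simp
    ultimately have "norm (w g) \<le> C" by auto
    then show "norm (inv P (w g)) \<le> B * C"
      using B(2)[of "w g"] B(1) by (meson mult_left_mono order_trans less_imp_le)
  next
    show "B > 0" by fact
    fix a b :: 'k assume "\<And>c. (c * a) \<bullet> 1 = (c * b) \<bullet> 1"
    then have "c \<bullet> P a = c \<bullet> P b" for c by (simp add: Pc)
    then have "P a = P b" by (metis inner_commute vector_eq_ldot)
    then show "a = b" using inj by (simp add: inj_eq)
  qed
qed

context banach_space_over
begin

lemma bounded_linear_scale: "bounded_linear (sc c)"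
proof (rule bounded_linear_intro[where K = "norm c"])
  show "sc c (r *\<^sub>R x) = r *\<^sub>R sc c x" for r x
    by (simp flip: scale_of_real add: mult.commute)
qed (simp_all add: scale_right_distrib norm_scale mult.commute)

text \<open>
  The real norming functional \<open>u\<close> is turned into a \<open>'k\<close>-linear \<open>f\<close> by requiring
  \<open>(c * f y) \<bullet> 1 = u (sc c y)\<close> for all \<open>c\<close>. This costs constants that depend only on \<open>'k\<close>, which is
  harmless for closedness and continuity arguments.
\<close>

lemma dual_space_norming:
  "\<exists>K>0. \<forall>x. \<exists>f\<in>dual_space sc. norm f \<le> K \<and> norm x \<le> K * norm (blinfun_apply f x)"
proof -
  obtain r :: "('k \<Rightarrow> real) \<Rightarrow> 'k" and B where r: "\<And>g c. linear g \<Longrightarrow> (c * r g) \<bullet> 1 = g c"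
    and B: "\<And>g C. linear g \<Longrightarrow> (\<And>c. \<bar>g c\<bar> \<le> C * norm c) \<Longrightarrow> norm (r g) \<le> B * C" "B > 0"
    and uniq: "\<And>a b :: 'k. (\<And>c. (c * a) \<bullet> 1 = (c * b) \<bullet> 1) \<Longrightarrow> a = b"
    using trace_form_represents by blast
  obtain D where D: "D > 0" "\<And>a::'k. \<bar>a \<bullet> 1\<bar> \<le> D * norm a"
    using Cauchy_Schwarz_ineq2[of _ "1::'k"]
    by (metis bounded_linear.pos_bounded bounded_linear_inner_left real_norm_def mult.commute)
  have "\<exists>f\<in>dual_space sc. norm f \<le> B + D \<and> norm x \<le> (B + D) * norm (blinfun_apply f x)" for x
  proof -
    obtain u where u: "linear u" "\<And>y. \<bar>u y\<bar> \<le> norm y" "u x = norm x"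
      using norming_functional_real by blast
    define f where "f y = r (\<lambda>c. u (sc c y))" for y
    have lin: "linear (\<lambda>c. u (sc c y))" for y
    proof (rule linearI)
      show "u (sc (a + b) y) = u (sc a y) + u (sc b y)" for a b
        by (simp add: scale_left_distrib linear_add[OF u(1)])
      show "u (sc (t *\<^sub>R a) y) = t *\<^sub>R u (sc a y)" for t a
        using linear_scale[OF u(1), of t "sc a y"]
        by (simp add: scaleR_conv_of_real flip: scale_of_real)
    qed
    have tr: "(c * f y) \<bullet> 1 = u (sc c y)" for c y
      unfolding f_def by (rule r[OF lin])
    have add: "f (y + z) = f y + f z" for y z
      by (rule uniq) (simp add: tr distrib_left inner_add_left scale_right_distrib linear_add[OF u(1)])
    have mult: "f (sc d y) = d * f y" for d y
      by (rule uniq) (simp add: tr flip: mult.assoc)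
    have bound: "norm (f y) \<le> B * norm y" for y
      unfolding f_def
    proof (rule B(1)[OF lin])
      show "\<bar>u (sc c y)\<bar> \<le> norm y * norm c" for c
        using u(2)[of "sc c y"] by (simp add: norm_scale mult.commute)
    qed
    have bl: "bounded_linear f"
    proof (rule bounded_linear_intro[where K = B])
      show "f (a *\<^sub>R y) = a *\<^sub>R f y" for a y
        using mult[of "of_real a" y] by (simp add: scale_of_real scaleR_conv_of_real)
    qed (use add bound in \<open>auto simp: mult.commute\<close>)
    have "Blinfun f \<in> dual_space sc"
      using mult by (simp add: dual_space_def bounded_linear_Blinfun_apply[OF bl])
    moreover have "norm (Blinfun f) \<le> B + D"
      using bound B(2) D(1)
      by (intro order_trans[OF norm_blinfun_bound[of B]]) (auto simp: bounded_linear_Blinfun_apply[OF bl])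
    moreover have "norm x \<le> (B + D) * norm (f x)"
    proof -
      have "norm x = f x \<bullet> 1" using tr[of 1 x] u(3) by simp
      also have "\<dots> \<le> D * norm (f x)" using D(2)[of "f x"] by simp
      also have "\<dots> \<le> (B + D) * norm (f x)" using B(2) by (intro mult_right_mono) auto
      finally show ?thesis .
    qed
    ultimately show ?thesis by (auto simp: bounded_linear_Blinfun_apply[OF bl])
  qed
  then show ?thesis using B(2) D(1) by (intro exI[of _ "B + D"]) auto
qed

end


section \<open>Uniform boundedness\<close>

text \<open>
  If an operator were small on a ball around \<open>x\<close>, then taking differences of opposite points would
  make it small on a ball around \<open>0\<close>. Any factor below \<open>1\<close> could replace \<open>2 / 3\<close>.
\<close>

lemma blinfun_large_nearby:
  fixes T :: "'a::real_normed_vector \<Rightarrow>\<^sub>L 'b::real_normed_vector"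
  assumes "r > 0"
  shows "\<exists>y. norm (y - x) \<le> r \<and> 2 / 3 * r * norm T \<le> norm (T y)"
proof (rule ccontr)
  assume neg: "\<not> ?thesis"
  have small: "norm (T y) < 2 / 3 * r * norm T" if "norm (y - x) \<le> r" for y
    using neg that by (meson not_le)
  have "0 < 2 / 3 * r * norm T"
    using small[of x] assms norm_ge_zero[of "T x"] by (simp del: norm_ge_zero)
  then have T: "norm T > 0" using assms by (simp add: zero_less_mult_iff)
  have "norm (T z) \<le> 2 / 3 * norm T * norm z" for z
  proof (cases "z = 0")
    case False
    define w where "w = (r / norm z) *\<^sub>R z"
    have "norm w = r" using False assms by (simp add: w_def)
    then have "norm (T (x + w)) < 2 / 3 * r * norm T" "norm (T (x - w)) < 2 / 3 * r * norm T"
      using small[of "x + w"] small[of "x - w"] by simp_all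
    moreover have "2 *\<^sub>R T w = T (x + w) - T (x - w)"
      by (simp add: blinfun.add_right blinfun.diff_right scaleR_2)
    then have "2 * norm (T w) \<le> norm (T (x + w)) + norm (T (x - w))"
      using norm_triangle_ineq4[of "T (x + w)" "T (x - w)"] by (metis norm_scaleR abs_numeral)
    ultimately have "norm (T w) \<le> 2 / 3 * r * norm T" by linarith
    then show ?thesis
      using False assms by (simp add: w_def blinfun.scaleR_right field_simps)
  qed simp
  then have "norm T \<le> 2 / 3 * norm T" using T by (intro norm_blinfun_bound) auto
  with T show False by simp
qed

text \<open>
  A gliding hump argument: if \<open>norm (T n) > 4 ^ n\<close>, choose successive points at distance at most
  \<open>(1/3) ^ n\<close> where \<open>T n\<close> is large. The later steps move the point by at most half of the last step,
  which cannot undo the size of \<open>T n\<close>, and at the limit the values grow like \<open>(4/3) ^ n\<close>.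
\<close>

theorem uniform_boundedness:
  fixes F :: "('a::banach \<Rightarrow>\<^sub>L 'b::real_normed_vector) set"
  assumes bdd: "\<And>x. bounded ((\<lambda>T. blinfun_apply T x) ` F)"
  shows "bounded F"
proof (rule ccontr)
  assume "\<not> bounded F"
  then have "\<exists>T\<in>F. 4 ^ n < norm T" for n :: nat unfolding bounded_iff by (meson not_le)
  then obtain T where TF: "\<And>n. T n \<in> F" and T: "\<And>n. (4::real) ^ n < norm (T n)" by metis
  have step: "\<exists>y. norm (y - x) \<le> (1/3) ^ n \<and> 2 / 3 * (1/3) ^ n * norm (T n) \<le> norm (T n y)" for n x
    by (rule blinfun_large_nearby) simp
  define g where "g n x = (SOME y. norm (y - x) \<le> (1/3) ^ n \<and>
      2 / 3 * (1/3) ^ n * norm (T n) \<le> norm (T n y))" for n x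
  have g: "norm (g n x - x) \<le> (1/3) ^ n" "2 / 3 * (1/3) ^ n * norm (T n) \<le> norm (T n (g n x))" for n x
    using someI_ex[OF step[of x n]] unfolding g_def by auto
  define u where "u = rec_nat 0 (\<lambda>n. g n)"
  have u: "u (Suc n) = g n (u n)" for n by (simp add: u_def)
  have dist: "norm (u (n + k) - u n) \<le> 3 / 2 * (1/3) ^ n * (1 - (1/3) ^ k)" for n k
  proof (induction k)
    case (Suc k)
    have "norm (u (Suc (n + k)) - u n) \<le> norm (u (Suc (n + k)) - u (n + k)) + norm (u (n + k) - u n)"
      using norm_triangle_ineq[of "u (Suc (n + k)) - u (n + k)" "u (n + k) - u n"] by simp
    also have "\<dots> \<le> (1/3) ^ (n + k) + 3 / 2 * (1/3) ^ n * (1 - (1/3) ^ k)"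
      using g(1)[of "n + k" "u (n + k)"] Suc by (simp add: u)
    also have "\<dots> = 3 / 2 * (1/3) ^ n * (1 - (1/3) ^ Suc k)"
      by (simp add: power_add field_simps)
    finally show ?case by simp
  qed simp
  have dist': "norm (u m - u n) \<le> 3 / 2 * (1/3) ^ n" if "n \<le> m" for n m
  proof -
    have "norm (u m - u n) \<le> 3 / 2 * (1/3) ^ n * (1 - (1/3) ^ (m - n))"
      using dist[of n "m - n"] that by simp
    also have "\<dots> \<le> 3 / 2 * (1/3) ^ n" by (simp add: algebra_simps)
    finally show ?thesis .
  qed
  have "Cauchy u"
  proof (rule CauchyI)
    fix e :: real assume "e > 0"
    then obtain N where N: "(1/3::real) ^ N < e / 3" using real_arch_pow_inv[of "e/3" "1/3"] by auto
    have "norm (u m - u n) < e" if "m \<ge> N" "n \<ge> N" for m n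
      using dist'[OF that(1)] dist'[OF that(2)] norm_triangle_ineq4[of "u m - u N" "u n - u N"] N by simp
    then show "\<exists>M. \<forall>m\<ge>M. \<forall>n\<ge>M. norm (u m - u n) < e" by blast
  qed
  then obtain x where x: "u \<longlonglongrightarrow> x" using convergent_eq_Cauchy by blast
  have lim: "norm (x - u (Suc n)) \<le> 1 / 2 * (1/3) ^ n" for n
  proof (rule LIMSEQ_le_const2)
    show "(\<lambda>m. norm (u m - u (Suc n))) \<longlonglongrightarrow> norm (x - u (Suc n))"
      by (intro tendsto_intros x)
    show "\<exists>N. \<forall>m\<ge>N. norm (u m - u (Suc n)) \<le> 1 / 2 * (1/3) ^ n"
      using dist'[of "Suc n"] by (intro exI[of _ "Suc n"]) simp
  qed
  have low: "1 / 6 * (4/3) ^ n \<le> norm (T n x)" for n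
  proof -
    have "norm (T n (u (Suc n)) - T n x) \<le> norm (T n) * norm (x - u (Suc n))"
      using norm_blinfun[of "T n" "u (Suc n) - x"] by (simp add: blinfun.diff_right norm_minus_commute)
    also have "\<dots> \<le> norm (T n) * (1 / 2 * (1/3) ^ n)" by (intro mult_left_mono lim) simp
    finally have "1 / 6 * (1/3) ^ n * norm (T n) \<le> norm (T n x)"
      using g(2)[of n "u n"] norm_triangle_ineq2[of "T n (u (Suc n))" "T n x"]
      by (simp add: u mult.commute)
    moreover have "1 / 6 * (1/3) ^ n * 4 ^ n \<le> 1 / 6 * (1/3) ^ n * norm (T n)"
      using T[of n] by (intro mult_left_mono) auto
    moreover have "(1 / 6) * (4/3::real) ^ n = 1 / 6 * (1/3) ^ n * 4 ^ n"
      by (simp add: power_divide)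
    ultimately show ?thesis by linarith
  qed
  obtain B where B: "\<And>n. norm (T n x) \<le> B"
    using bdd[of x] TF unfolding bounded_iff by blast
  obtain n where "6 * B < (4/3::real) ^ n" using real_arch_pow[of "4/3" "6 * B"] by auto
  with low[of n] B[of n] show False by simp
qed


section \<open>Orbits of a strongly continuous semigroup\<close>

text \<open>
  The common form of the continuity of orbits in the space and in the sun dual: continuity at \<open>0\<close>
  propagates by the semigroup law on intervals where the semigroup is bounded.
\<close>

lemma continuous_on_modulus:
  fixes u :: "real \<Rightarrow> 'v::real_normed_vector"
  assumes g: "(g \<longlongrightarrow> 0) (at_right 0)" "g 0 = 0"
    and mod: "\<And>b. \<exists>M. \<forall>s\<in>{0..b}. \<forall>t\<in>{0..b}. s \<le> t \<longrightarrow> norm (u t - u s) \<le> M * g (t - s)"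
  shows "continuous_on {0..} u"
proof (unfold continuous_on_iff, intro ballI allI impI)
  fix t e :: real assume t: "t \<in> {0..}" and e: "e > 0"
  obtain M where M: "\<And>s r. s \<in> {0..t+1} \<Longrightarrow> r \<in> {0..t+1} \<Longrightarrow> s \<le> r \<Longrightarrow> norm (u r - u s) \<le> M * g (r - s)"
    using mod[of "t + 1"] by blast
  have "e / (\<bar>M\<bar> + 1) > 0" using e by simp
  from tendstoD[OF g(1) this] obtain d where d: "d > 0"
    and gd: "\<And>h. 0 < h \<Longrightarrow> h < d \<Longrightarrow> \<bar>g h\<bar> < e / (\<bar>M\<bar> + 1)"
    unfolding eventually_at_right_field by auto
  have Mg: "M * g h < e" if "0 \<le> h" "h < d" for h
  proof -
    have "\<bar>g h\<bar> < e / (\<bar>M\<bar> + 1)" using gd[of h] that g(2) e by (cases "h = 0") auto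
    then have "\<bar>g h\<bar> * (\<bar>M\<bar> + 1) < e" by (simp add: less_divide_eq)
    moreover have "M * g h \<le> \<bar>g h\<bar> * (\<bar>M\<bar> + 1)"
      using abs_ge_self[of "M * g h"] by (simp add: abs_mult distrib_left mult.commute)
    ultimately show ?thesis by linarith
  qed
  have "dist (u s) (u t) < e" if s: "s \<in> {0..}" "dist s t < min d 1" for s
  proof (cases "s \<le> t")
    case True
    then show ?thesis using M[of s t] Mg[of "t - s"] s t by (auto simp: dist_norm norm_minus_commute)
  next
    case False
    then show ?thesis using M[of t s] Mg[of "s - t"] s t by (auto simp: dist_norm)
  qed
  moreover have "min d 1 > 0" using d by simp
  ultimately show "\<exists>d>0. \<forall>s\<in>{0..}. dist s t < d \<longrightarrow> dist (u s) (u t) < e" by blast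
qed

lemma integral_average_bound:
  fixes u :: "real \<Rightarrow> 'v::banach"
  assumes "a \<le> b" "continuous_on {a..b} u" "\<And>s. s \<in> {a..b} \<Longrightarrow> norm (u s - y) \<le> e"
  shows "norm (integral {a..b} u - (b - a) *\<^sub>R y) \<le> e * (b - a)"
proof -
  have "integral {a..b} (\<lambda>s. u s - y) = integral {a..b} u - (b - a) *\<^sub>R y"
    using assms by (simp add: integral_diff integrable_continuous_interval)
  moreover have "norm (integral {a..b} (\<lambda>s. u s - y)) \<le> e * (b - a)"
    using assms by (intro integral_bound continuous_intros)
  ultimately show ?thesis by simp
qed


lemma integral_average_tendsto:
  fixes u :: "real \<Rightarrow> 'v::banach"
  assumes "continuous_on {0..} u"
  shows "((\<lambda>h. integral {0..h} u /\<^sub>R h) \<longlongrightarrow> u 0) (at_right 0)"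
proof (rule tendstoI)
  fix e :: real assume e: "e > 0"
  have "(u \<longlongrightarrow> u 0) (at_right 0)"
    using assms by (simp add: continuous_on_def flip: at_within_Ici_at_right)
  from tendstoD[OF this, of "e / 2"] e obtain d where d: "d > 0"
    and ud: "\<And>h. 0 < h \<Longrightarrow> h < d \<Longrightarrow> norm (u h - u 0) < e / 2"
    unfolding eventually_at_right_field dist_norm by auto
  have "dist (integral {0..h} u /\<^sub>R h) (u 0) < e" if h: "0 < h" "h < d" for h
  proof -
    have "norm (u s - u 0) \<le> e / 2" if "s \<in> {0..h}" for s
      using ud[of s] that h e by (cases "s = 0") auto
    then have "norm (integral {0..h} u - (h - 0) *\<^sub>R u 0) \<le> e / 2 * (h - 0)"
      using h by (intro integral_average_bound continuous_on_subset[OF assms]) auto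
    moreover have "integral {0..h} u /\<^sub>R h - u 0 = (integral {0..h} u - h *\<^sub>R u 0) /\<^sub>R h"
      using h by (simp add: scaleR_diff_right)
    ultimately have "dist (integral {0..h} u /\<^sub>R h) (u 0) \<le> e / 2"
      using h by (simp add: dist_norm divide_le_eq flip: divide_inverse_commute)
    then show ?thesis using e by simp
  qed
  then show "\<forall>\<^sub>F h in at_right 0. dist (integral {0..h} u /\<^sub>R h) (u 0) < e"
    using d unfolding eventually_at_right_field by blast
qed

locale c0_semigroup_on = banach_space_over sc
  for sc :: "'k::{real_normed_field,euclidean_space} \<Rightarrow> 'a::banach \<Rightarrow> 'a" +
  fixes T :: "real \<Rightarrow> 'a \<Rightarrow>\<^sub>L 'a"
  assumes c0: "c0_semigroup sc T"
begin

lemma T_scale: "t \<ge> 0 \<Longrightarrow> T t (sc c x) = sc c (T t x)"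
  and T_0 [simp]: "T 0 = id_blinfun"
  and T_compose: "s \<ge> 0 \<Longrightarrow> t \<ge> 0 \<Longrightarrow> T (s + t) = T s o\<^sub>L T t"
  and T_add: "s \<ge> 0 \<Longrightarrow> t \<ge> 0 \<Longrightarrow> T (s + t) x = T s (T t x)"
  and T_tendsto: "((\<lambda>t. T t x) \<longlongrightarrow> x) (at_right 0)"
  using c0 by (auto simp: c0_semigroup_def)

text \<open>
  Otherwise the operators along some sequence of times tending to \<open>0\<close> would have unbounded norms,
  although the orbits converge along it.
\<close>

lemma T_bounded_near_0: "\<exists>d>0. \<exists>M. \<forall>t\<in>{0..d}. norm (T t) \<le> M"
proof (rule ccontr)
  assume neg: "\<not> ?thesis"
  have "\<exists>t. 0 \<le> t \<and> t \<le> 1 / Suc n \<and> real n < norm (T t)" for n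
    using neg by (metis atLeastAtMost_iff not_le of_nat_0_less_iff zero_less_Suc zero_less_divide_1_iff)
  then obtain t where t: "\<And>n. 0 \<le> t n" "\<And>n. t n \<le> 1 / Suc n" "\<And>n. real n < norm (T (t n))"
    by metis
  have t0: "t \<longlonglongrightarrow> 0"
    by (rule tendsto_sandwich[OF _ _ tendsto_const LIMSEQ_Suc[OF lim_1_over_n]])
       (use t in \<open>auto simp: field_simps\<close>)
  have "bounded (range (\<lambda>n. T (t n)))"
  proof (rule uniform_boundedness)
    fix x
    have "((\<lambda>t. T t x) \<longlongrightarrow> T 0 x) (at 0 within {0..})"
      using T_tendsto[of x] by (simp add: at_within_Ici_at_right)
    then have "continuous (at 0 within {0..}) (\<lambda>t. T t x)" by (simp add: continuous_within)
    then have "(\<lambda>n. T (t n) x) \<longlonglongrightarrow> T 0 x"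
      using t(1) t0 unfolding continuous_within_sequentially by (auto simp: o_def)
    then have "bounded (range (\<lambda>n. T (t n) x))" using convergent_imp_bounded by blast
    then show "bounded ((\<lambda>A. blinfun_apply A x) ` range (\<lambda>n. T (t n)))" by (simp add: image_image)
  qed
  then obtain B where "\<And>n. norm (T (t n)) \<le> B" unfolding bounded_iff by auto
  moreover obtain n where "B < real n" using reals_Archimedean2 by blast
  ultimately show False using t(3)[of n] by (meson less_le_trans less_asym order.strict_trans1 not_le)
qed

lemma T_bounded: "\<exists>M\<ge>1. \<forall>t\<in>{0..b}. norm (T t) \<le> M"
proof -
  obtain d M where d: "d > 0" and M: "\<And>t. t \<in> {0..d} \<Longrightarrow> norm (T t) \<le> M"
    using T_bounded_near_0 by blast
  have "\<exists>B. \<forall>t\<in>{0..real n * d}. norm (T t) \<le> B" for n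
  proof (induction n)
    case 0
    show ?case using M[of 0] d by auto
  next
    case (Suc n)
    then obtain B where B: "\<And>t. t \<in> {0..real n * d} \<Longrightarrow> norm (T t) \<le> B" by blast
    have "norm (T t) \<le> max M (M * B)" if t: "t \<in> {0..real (Suc n) * d}" for t
    proof (cases "t \<le> d")
      case True then show ?thesis using M[of t] t by simp
    next
      case False
      have "T t = T d o\<^sub>L T (t - d)"
        using T_compose[of d "t - d"] False d by simp
      then have "norm (T t) \<le> norm (T d) * norm (T (t - d))" by (simp add: norm_blinfun_compose)
      also have "\<dots> \<le> M * B"
        using M[of d] B[of "t - d"] False t d order_trans[OF norm_ge_zero M[of d]]
        by (intro mult_mono) (auto simp: algebra_simps)
      finally show ?thesis by simp
    qed
    then show ?case by blast
  qed
  moreover obtain n where "b / d < real n" using reals_Archimedean2 by blast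
  then have "b < real n * d" using d by (simp add: divide_less_eq)
  ultimately obtain B where B: "\<And>t. t \<in> {0..b} \<Longrightarrow> norm (T t) \<le> B"
    by (meson atLeastAtMost_iff less_imp_le order_trans)
  have "\<forall>t\<in>{0..b}. norm (T t) \<le> max 1 B"
    using B by (auto simp: le_max_iff_disj)
  then show ?thesis by (intro exI[of _ "max 1 B"]) auto
qed

end

context c0_semigroup_on
begin

lemma T_orbit_diff:
  assumes M: "\<And>t. t \<in> {0..b} \<Longrightarrow> norm (T t) \<le> M" and st: "0 \<le> s" "s \<le> t" "t \<le> b"
  shows "norm (T t x - T s x) \<le> M * norm (T (t - s) x - x)"
proof -
  have "T t x - T s x = T s (T (t - s) x - x)"
    using T_add[of s "t - s" x] st by (simp add: blinfun.diff_right)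
  also have "norm \<dots> \<le> norm (T s) * norm (T (t - s) x - x)" by (rule norm_blinfun)
  also have "\<dots> \<le> M * norm (T (t - s) x - x)" using M st by (intro mult_right_mono) auto
  finally show ?thesis .
qed

lemma orbit_continuous: "continuous_on {0..} (\<lambda>t. T t x)"
proof (rule continuous_on_modulus)
  show "((\<lambda>h. norm (T h x - x)) \<longlongrightarrow> 0) (at_right 0)"
    using T_tendsto[of x] by (simp add: tendsto_norm_zero_iff LIM_zero_iff)
  fix b
  obtain M where "\<forall>t\<in>{0..b}. norm (T t) \<le> M" using T_bounded by blast
  then show "\<exists>M. \<forall>s\<in>{0..b}. \<forall>t\<in>{0..b}. s \<le> t \<longrightarrow> norm (T t x - T s x) \<le> M * norm (T (t - s) x - x)"
    using T_orbit_diff[of b M] by (intro exI[of _ M]) auto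
qed simp

lemma orbit_continuous_on: "0 \<le> a \<Longrightarrow> continuous_on {a..b} (\<lambda>t. T t x)"
  using continuous_on_subset[OF orbit_continuous] by auto

lemma orbit_integrable: "0 \<le> a \<Longrightarrow> (\<lambda>t. T t x) integrable_on {a..b}"
  by (intro integrable_continuous_interval orbit_continuous_on)

definition orbit_integral :: "real \<Rightarrow> 'a \<Rightarrow>\<^sub>L 'a"
  where "orbit_integral t = Blinfun (\<lambda>x. integral {0..t} (\<lambda>s. T s x))"

lemma norm_integral_orbit:
  assumes "\<And>s. s \<in> {0..b} \<Longrightarrow> norm (T s) \<le> M" "0 \<le> t" "t \<le> b"
  shows "norm (integral {0..t} (\<lambda>s. T s x)) \<le> M * t * norm x"
proof -
  have "norm (integral {0..t} (\<lambda>s. T s x)) \<le> (M * norm x) * (t - 0)"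
  proof (rule integral_bound)
    fix s assume "s \<in> {0..t}"
    then show "norm (T s x) \<le> M * norm x"
      using norm_blinfun[of "T s" x] assms mult_right_mono[of "norm (T s)" M "norm x"] by fastforce
  qed (use assms orbit_continuous_on in auto)
  then show ?thesis by (simp add: mult_ac)
qed

lemma orbit_integral_apply:
  assumes "t \<ge> 0"
  shows "orbit_integral t x = integral {0..t} (\<lambda>s. T s x)"
proof -
  obtain M where M: "\<And>s. s \<in> {0..t} \<Longrightarrow> norm (T s) \<le> M" using T_bounded by blast
  have "bounded_linear (\<lambda>x. integral {0..t} (\<lambda>s. T s x))"
    by (rule bounded_linear_intro[where K = "M * t"])
      (use assms norm_integral_orbit[OF M assms order_refl] in
        \<open>auto simp: blinfun.add_right blinfun.scaleR_right integral_add orbit_integrable mult_ac\<close>)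
  then show ?thesis by (simp add: orbit_integral_def bounded_linear_Blinfun_apply)
qed

lemma norm_orbit_integral:
  assumes "\<And>s. s \<in> {0..b} \<Longrightarrow> norm (T s) \<le> M" "0 \<le> t" "t \<le> b"
  shows "norm (orbit_integral t) \<le> M * t"
proof (rule norm_blinfun_bound)
  have "M \<ge> 0" using assms(1)[of 0] assms(2,3) norm_ge_zero[of "T 0"] by (simp del: T_0 norm_ge_zero)
  then show "0 \<le> M * t" using assms by simp
qed (use norm_integral_orbit[OF assms] assms in \<open>simp add: orbit_integral_apply\<close>)

lemma orbit_integral_0 [simp]: "orbit_integral 0 = 0"
  by (rule blinfun_eqI) (simp add: orbit_integral_apply)

lemma orbit_integral_scale:
  assumes "t \<ge> 0"
  shows "orbit_integral t (sc c x) = sc c (orbit_integral t x)"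
proof -
  have "integral {0..t} (\<lambda>s. T s (sc c x)) = integral {0..t} (\<lambda>s. sc c (T s x))"
    by (intro integral_cong) (simp add: T_scale)
  then show ?thesis
    using integral_linear[OF orbit_integrable[of 0 x t] bounded_linear_scale[of c]] assms
    by (simp add: orbit_integral_apply o_def)
qed

lemma orbit_integral_T:
  assumes "h \<ge> 0" "t \<ge> 0"
  shows "orbit_integral t (T h x) = orbit_integral (t + h) x - orbit_integral h x"
    and "T h (orbit_integral t x) = orbit_integral (t + h) x - orbit_integral h x"
proof -
  have eq: "integral {0..t} (\<lambda>s. T (h + s) x) = orbit_integral (t + h) x - orbit_integral h x"
    using integral_shift_Icc_real[of 0 t "\<lambda>s. T s x" h] assms
      Henstock_Kurzweil_Integration.integral_combine[of 0 h "t + h" "\<lambda>s. T s x"] orbit_integrable[of 0 x "t + h"]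
    by (simp add: o_def orbit_integral_apply algebra_simps)
  have "integral {0..t} (\<lambda>s. T s (T h x)) = integral {0..t} (\<lambda>s. T (h + s) x)"
    using assms by (intro integral_cong) (auto simp: add.commute[of h] T_add)
  then show "orbit_integral t (T h x) = orbit_integral (t + h) x - orbit_integral h x"
    using assms eq by (simp add: orbit_integral_apply)
  have "T h (integral {0..t} (\<lambda>s. T s x)) = integral {0..t} (\<lambda>s. T h (T s x))"
    using integral_linear[OF orbit_integrable[of 0 x t] blinfun.bounded_linear_right[of "T h"]]
    by (simp add: o_def)
  also have "\<dots> = integral {0..t} (\<lambda>s. T (h + s) x)"
    using assms by (intro integral_cong) (auto simp: T_add)
  finally show "T h (orbit_integral t x) = orbit_integral (t + h) x - orbit_integral h x"
    using assms eq by (simp add: orbit_integral_apply)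
qed

text \<open>
  Both sides equal the integral over \<open>{0..t + h}\<close> minus those over \<open>{0..t}\<close> and \<open>{0..h}\<close>, which is symmetric in
  \<open>t\<close> and \<open>h\<close>. Difference quotients of time integrals thereby become averages of orbits, and this
  is the source of every differentiability statement below.
\<close>

lemma orbit_integral_exchange:
  assumes "h \<ge> 0" "t \<ge> 0"
  shows "T h (orbit_integral t x) - orbit_integral t x = orbit_integral h (T t x - x)"
    and "orbit_integral t (T h x - x) = orbit_integral h (T t x - x)"
  using orbit_integral_T[OF assms] orbit_integral_T[OF assms(2,1)]
  by (simp_all add: blinfun.diff_right add.commute)

lemma orbit_integral_average: "((\<lambda>h. orbit_integral h x /\<^sub>R h) \<longlongrightarrow> x) (at_right 0)"
proof -
  have "((\<lambda>h. integral {0..h} (\<lambda>s. T s x) /\<^sub>R h) \<longlongrightarrow> x) (at_right 0)"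
    using integral_average_tendsto[OF orbit_continuous, of x] by simp
  then show ?thesis
    by (rule Lim_transform_eventually)
      (use eventually_at_right_less in \<open>eventually_elim, simp add: orbit_integral_apply\<close>)
qed

lemma orbit_integral_in_generator:
  assumes "t \<ge> 0"
  shows "(orbit_integral t x, T t x - x) \<in> generator UNIV (\<lambda>t. blinfun_apply (T t))"
proof -
  have "((\<lambda>h. (T h (orbit_integral t x) - orbit_integral t x) /\<^sub>R h) \<longlongrightarrow> T t x - x) (at_right 0)"
    by (rule Lim_transform_eventually[OF orbit_integral_average])
      (use eventually_at_right_less in \<open>eventually_elim, simp add: orbit_integral_exchange(1) assms\<close>)
  then show ?thesis by (simp add: generator_def)
qed

text \<open>
  The difference quotients of \<open>z\<close> converge in norm and the integral operator is bounded, so the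
  limit can be taken inside.
\<close>

lemma generator_integral:
  assumes gen: "(z, w) \<in> generator UNIV (\<lambda>t. blinfun_apply (T t))" and t: "t \<ge> 0"
  shows "orbit_integral t w = T t z - z"
proof (rule tendsto_unique[OF trivial_limit_at_right_real])
  have "((\<lambda>h. (T h z - z) /\<^sub>R h) \<longlongrightarrow> w) (at_right 0)"
    using gen by (simp add: generator_def)
  then show "((\<lambda>h. orbit_integral t ((T h z - z) /\<^sub>R h)) \<longlongrightarrow> orbit_integral t w) (at_right 0)"
    by (intro tendsto_intros)
  show "((\<lambda>h. orbit_integral t ((T h z - z) /\<^sub>R h)) \<longlongrightarrow> T t z - z) (at_right 0)"
    by (rule Lim_transform_eventually[OF orbit_integral_average])
      (use eventually_at_right_less in
        \<open>eventually_elim, simp add: orbit_integral_exchange(2) t blinfun.scaleR_right\<close>)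
qed

end


section \<open>The sun dual\<close>

context c0_semigroup_on
begin

abbreviation S :: "('a \<Rightarrow>\<^sub>L 'k) set"
  where "S \<equiv> sun_dual sc T"

lemma in_sun_dual_iff:
  "f \<in> S \<longleftrightarrow> f \<in> dual_space sc \<and> ((\<lambda>t. f o\<^sub>L T t) \<longlongrightarrow> f) (at_right 0)"
  by (simp add: sun_dual_def adjoint_semigroup_def tendsto_norm_zero_iff LIM_zero_iff)

lemma dual_of_scale: "f \<in> dual_space sc \<Longrightarrow> blinfun_apply f (sc c x) = c * f x"
  by (simp add: dual_space_def)

lemma scale_dual_apply [simp]: "blinfun_apply (scale_dual c f) x = c * f x"
  by (simp add: scale_dual_def)

lemma scale_dual_of_real: "scale_dual (of_real r) f = r *\<^sub>R f"
  by (rule blinfun_eqI) (simp add: blinfun.scaleR_left scaleR_conv_of_real)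

lemma sun_dual_zero [simp]: "0 \<in> S"
  by (simp add: in_sun_dual_iff dual_space_def)

lemma sun_dual_add: "f \<in> S \<Longrightarrow> g \<in> S \<Longrightarrow> f + g \<in> S"
  using tendsto_add[of "\<lambda>t. f o\<^sub>L T t" f "at_right 0" "\<lambda>t. g o\<^sub>L T t" g]
  by (simp add: in_sun_dual_iff dual_space_def blinfun.add_left distrib_left
      bounded_bilinear.add_left[OF bounded_bilinear_blinfun_compose])

lemma sun_dual_scaleR: "f \<in> S \<Longrightarrow> r *\<^sub>R f \<in> S"
  using tendsto_scaleR[OF tendsto_const, of "\<lambda>t. f o\<^sub>L T t" f "at_right 0" r]
  by (simp add: in_sun_dual_iff dual_space_def blinfun.scaleR_left
      bounded_bilinear.scaleR_left[OF bounded_bilinear_blinfun_compose])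

lemma sun_dual_diff: "f \<in> S \<Longrightarrow> g \<in> S \<Longrightarrow> f - g \<in> S"
  using sun_dual_add[of f "(-1) *\<^sub>R g"] sun_dual_scaleR[of g "-1"] by simp

lemma norm_adjoint_le:
  fixes f :: "'a \<Rightarrow>\<^sub>L 'k"
  assumes "norm (A :: 'a \<Rightarrow>\<^sub>L 'a) \<le> M"
  shows "norm (f o\<^sub>L A) \<le> M * norm f"
  using norm_blinfun_compose[of f A] mult_left_mono[OF assms norm_ge_zero[of f]]
  by (simp add: mult.commute)

lemma adjoint_orbit_diff:
  fixes f :: "'a \<Rightarrow>\<^sub>L 'k"
  assumes M: "\<And>t. t \<in> {0..b} \<Longrightarrow> norm (T t) \<le> M" and st: "0 \<le> s" "s \<le> t" "t \<le> b"
  shows "norm ((f o\<^sub>L T t) - (f o\<^sub>L T s)) \<le> M * norm ((f o\<^sub>L T (t - s)) - f)"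
proof -
  have "(f o\<^sub>L T t) - (f o\<^sub>L T s) = ((f o\<^sub>L T (t - s)) - f) o\<^sub>L T s"
    using T_add[of "t - s" s] st
    by (intro blinfun_eqI) (simp add: blinfun.diff_left)
  then show ?thesis using norm_adjoint_le[OF M[of s]] st by simp
qed

lemma adjoint_orbit_continuous:
  assumes "f \<in> S"
  shows "continuous_on {0..} (\<lambda>t. f o\<^sub>L T t)"
proof (rule continuous_on_modulus)
  show "((\<lambda>h. norm ((f o\<^sub>L T h) - f)) \<longlongrightarrow> 0) (at_right 0)"
    using assms by (simp add: tendsto_norm_zero_iff LIM_zero_iff in_sun_dual_iff)
  show "norm ((f o\<^sub>L T 0) - f) = 0" by simp (metis blinfun_eqI blinfun_apply_blinfun_compose id_blinfun.rep_eq)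
  fix b
  obtain M where "\<forall>t\<in>{0..b}. norm (T t) \<le> M" using T_bounded by blast
  then show "\<exists>M. \<forall>s\<in>{0..b}. \<forall>t\<in>{0..b}. s \<le> t \<longrightarrow>
      norm ((f o\<^sub>L T t) - (f o\<^sub>L T s)) \<le> M * norm ((f o\<^sub>L T (t - s)) - f)"
    using adjoint_orbit_diff[of b M] by (intro exI[of _ M]) auto
qed

lemma adjoint_orbit_continuous_on:
  "f \<in> S \<Longrightarrow> 0 \<le> a \<Longrightarrow> continuous_on {a..b} (\<lambda>t. f o\<^sub>L T t)"
  using continuous_on_subset[OF adjoint_orbit_continuous] by auto

lemma sun_dual_T:
  assumes f: "f \<in> S" and t: "t \<ge> 0"
  shows "f o\<^sub>L T t \<in> S"
proof -
  have "((\<lambda>h. (f o\<^sub>L T h) o\<^sub>L T t) \<longlongrightarrow> f o\<^sub>L T t) (at_right 0)"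
    using f by (intro tendsto_intros) (simp add: in_sun_dual_iff)
  then have "((\<lambda>h. (f o\<^sub>L T t) o\<^sub>L T h) \<longlongrightarrow> f o\<^sub>L T t) (at_right 0)"
  proof (rule Lim_transform_eventually)
    show "\<forall>\<^sub>F h in at_right 0. (f o\<^sub>L T h) o\<^sub>L T t = (f o\<^sub>L T t) o\<^sub>L T h"
      using eventually_at_right_less
      by eventually_elim (use t in \<open>auto intro!: blinfun_eqI simp: add.commute simp flip: T_add\<close>)
  qed
  then show ?thesis using f t by (simp add: in_sun_dual_iff dual_space_def T_scale)
qed

text \<open>
  Adjoints of integral operators map the whole dual space into the sun dual, which is why the sun dual
  is large enough to norm the space.
\<close>

lemma sun_dual_orbit_integral:
  assumes f: "f \<in> dual_space sc" and t: "t \<ge> 0"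
  shows "f o\<^sub>L orbit_integral t \<in> S"
proof -
  obtain M where M: "M \<ge> 1" "\<And>s. s \<in> {0..max t 1} \<Longrightarrow> norm (T s) \<le> M" using T_bounded by blast
  have "((\<lambda>h. (f o\<^sub>L orbit_integral t) o\<^sub>L T h) \<longlongrightarrow> f o\<^sub>L orbit_integral t) (at_right 0)"
  proof (rule Lim_transform_eventually[OF _ ])
    have "((\<lambda>h. orbit_integral h) \<longlongrightarrow> 0) (at_right 0)"
    proof (rule Lim_null_comparison)
      show "\<forall>\<^sub>F h in at_right 0. norm (orbit_integral h) \<le> M * h"
        using eventually_at_right_real[of 0 1]
        by (auto elim!: eventually_mono intro!: norm_orbit_integral[of "max t 1"] M(2))
      show "((\<lambda>h. M * h) \<longlongrightarrow> 0) (at_right 0)"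
        by (rule tendsto_eq_intros refl | simp)+
    qed
    then have "((\<lambda>h. (f o\<^sub>L orbit_integral t) + (f o\<^sub>L (orbit_integral h o\<^sub>L (T t - id_blinfun))))
        \<longlongrightarrow> (f o\<^sub>L orbit_integral t) + (f o\<^sub>L (0 o\<^sub>L (T t - id_blinfun)))) (at_right 0)"
      by (intro tendsto_intros)
    then show "((\<lambda>h. (f o\<^sub>L orbit_integral t) + (f o\<^sub>L (orbit_integral h o\<^sub>L (T t - id_blinfun))))
        \<longlongrightarrow> f o\<^sub>L orbit_integral t) (at_right 0)" by simp
    show "\<forall>\<^sub>F h in at_right 0. (f o\<^sub>L orbit_integral t) + (f o\<^sub>L (orbit_integral h o\<^sub>L (T t - id_blinfun)))
        = (f o\<^sub>L orbit_integral t) o\<^sub>L T h"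
      using eventually_at_right_less
    proof eventually_elim
      case (elim h)
      show ?case
      proof (rule blinfun_eqI)
        fix x
        show "blinfun_apply ((f o\<^sub>L orbit_integral t) + (f o\<^sub>L (orbit_integral h o\<^sub>L (T t - id_blinfun)))) x
          = blinfun_apply ((f o\<^sub>L orbit_integral t) o\<^sub>L T h) x"
          using orbit_integral_exchange(2)[of h t x] elim t
          by (simp add: blinfun.diff_left blinfun.add_left blinfun.diff_right algebra_simps flip: blinfun.add_right)
      qed
    qed
  qed
  then show ?thesis using f t by (simp add: in_sun_dual_iff dual_space_def orbit_integral_scale)
qed

lemma adjoint_orbit_integral:
  assumes f: "f \<in> S" and t: "t \<ge> 0"
  shows "f o\<^sub>L orbit_integral t = integral {0..t} (\<lambda>s. f o\<^sub>L T s)"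
proof (rule blinfun_eqI)
  fix x
  have "blinfun_apply (integral {0..t} (\<lambda>s. f o\<^sub>L T s)) x = integral {0..t} (\<lambda>s. f (T s x))"
    using integral_linear[OF integrable_continuous_interval[OF adjoint_orbit_continuous_on[OF f, of 0 t]]
        blinfun.bounded_linear_left[of x]] by (simp add: o_def)
  also have "\<dots> = f (integral {0..t} (\<lambda>s. T s x))"
    using integral_linear[OF orbit_integrable[of 0 x t] blinfun.bounded_linear_right[of f]]
    by (simp add: o_def)
  finally show "blinfun_apply (f o\<^sub>L orbit_integral t) x = blinfun_apply (integral {0..t} (\<lambda>s. f o\<^sub>L T s)) x"
    using t by (simp add: orbit_integral_apply)
qed

lemma adjoint_orbit_integral_average:
  assumes f: "f \<in> S"
  shows "((\<lambda>h. (f o\<^sub>L orbit_integral h) /\<^sub>R h) \<longlongrightarrow> f) (at_right 0)"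
proof -
  have "f o\<^sub>L id_blinfun = f" by (rule blinfun_eqI) simp
  then have "((\<lambda>h. integral {0..h} (\<lambda>s. f o\<^sub>L T s) /\<^sub>R h) \<longlongrightarrow> f) (at_right 0)"
    using integral_average_tendsto[OF adjoint_orbit_continuous[OF f]] by simp
  then show ?thesis
    by (rule Lim_transform_eventually)
      (use eventually_at_right_less in \<open>eventually_elim, simp add: adjoint_orbit_integral f\<close>)
qed

text \<open>
  For a norming functional \<open>f\<close>, the averages of its orbit lie in the sun dual, are bounded uniformly
  and converge to \<open>f\<close> pointwise.
\<close>

lemma sun_dual_norming:
  "\<exists>K>0. \<forall>x. \<forall>B\<ge>0. (\<forall>f\<in>S. norm (blinfun_apply f x) \<le> B * norm f) \<longrightarrow> norm x \<le> K * B"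
proof -
  obtain K where K: "K > 0" "\<And>x. \<exists>f\<in>dual_space sc. norm f \<le> K \<and> norm x \<le> K * norm (blinfun_apply f x)"
    using dual_space_norming by blast
  obtain M where M: "M \<ge> 1" "\<And>s. s \<in> {0..1} \<Longrightarrow> norm (T s) \<le> M" using T_bounded by blast
  have "norm x \<le> (K * (M * K)) * B" if B: "B \<ge> 0" and le: "\<And>f. f \<in> S \<Longrightarrow> norm (blinfun_apply f x) \<le> B * norm f" for x B
  proof -
    obtain f where f: "f \<in> dual_space sc" "norm f \<le> K" "norm x \<le> K * norm (blinfun_apply f x)" using K by blast
    have "norm (blinfun_apply f x) \<le> B * (M * K)"
    proof (rule tendsto_upperbound)
      show "((\<lambda>h. norm (f (orbit_integral h x /\<^sub>R h))) \<longlongrightarrow> norm (blinfun_apply f x)) (at_right 0)"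
        by (intro tendsto_intros orbit_integral_average)
      have "norm (f (orbit_integral h x /\<^sub>R h)) \<le> B * (M * K)" if h: "h \<in> {0<..<1}" for h
      proof -
        have "norm (f o\<^sub>L orbit_integral h) \<le> (M * h) * norm f"
          by (rule norm_adjoint_le, rule norm_orbit_integral[of 1]) (use M(2) h in auto)
        also have "\<dots> \<le> (M * h) * K" using f(2) M h by (intro mult_left_mono) auto
        finally have "norm (f (orbit_integral h x)) \<le> B * (M * h * K)"
          using le[OF sun_dual_orbit_integral[OF f(1), of h]] h mult_left_mono[OF _ B]
          by (fastforce intro: order_trans)
        then show ?thesis using h by (simp add: blinfun.scaleR_right divide_simps mult_ac)
      qed
      then show "\<forall>\<^sub>F h in at_right 0. norm (f (orbit_integral h x /\<^sub>R h)) \<le> B * (M * K)"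
        using eventually_at_right_real[of 0 1] by (auto elim: eventually_mono)
    qed simp
    then have "K * norm (blinfun_apply f x) \<le> K * (B * (M * K))" using K(1) by simp
    then show ?thesis using f(3) by (simp add: mult_ac)
  qed
  moreover have "K * (M * K) > 0" using K(1) M(1) by simp
  ultimately show ?thesis by blast
qed

text \<open>
  The range of the embedding is norm closed: approximating vectors form a Cauchy sequence because the
  sun dual norms the space.
\<close>

lemma embedding_range_closed:
  fixes \<Phi> :: "('a \<Rightarrow>\<^sub>L 'k) \<Rightarrow> 'k"
  assumes approx: "\<And>e. e > 0 \<Longrightarrow> \<exists>v. \<forall>f\<in>S. norm (blinfun_apply f v - \<Phi> f) \<le> e * norm f"
  shows "\<exists>v. \<forall>f\<in>S. blinfun_apply f v = \<Phi> f"
proof -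
  obtain K where K: "K > 0" "\<And>x B. B \<ge> 0 \<Longrightarrow> (\<And>f. f \<in> S \<Longrightarrow> norm (blinfun_apply f x) \<le> B * norm f) \<Longrightarrow> norm x \<le> K * B"
    using sun_dual_norming by blast
  have "\<exists>v. \<forall>f\<in>S. norm (blinfun_apply f v - \<Phi> f) \<le> (1 / real (Suc n)) * norm f" for n by (rule approx) simp
  then obtain v where v: "\<And>n f. f \<in> S \<Longrightarrow> norm (blinfun_apply f (v n) - \<Phi> f) \<le> (1 / real (Suc n)) * norm f" by metis
  have dist: "norm (v m - v n) \<le> K * (1 / real (Suc m) + 1 / real (Suc n))" for m n
  proof (rule K(2))
    fix f assume f: "f \<in> S"
    show "norm (f (v m - v n)) \<le> (1 / real (Suc m) + 1 / real (Suc n)) * norm f"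
      using v[OF f, of m] v[OF f, of n] norm_triangle_ineq4[of "f (v m) - \<Phi> f" "f (v n) - \<Phi> f"]
      by (simp add: blinfun.diff_right distrib_right)
  qed simp
  have "Cauchy v"
  proof (rule CauchyI)
    fix e :: real assume e: "e > 0"
    then obtain N where N: "1 / real (Suc N) < e / (2 * K)" 
      using K(1) nat_approx_posE[of "e / (2 * K)"] by auto
    have "norm (v m - v n) < e" if "m \<ge> N" "n \<ge> N" for m n
    proof -
      have "1 / real (Suc m) \<le> 1 / real (Suc N)" "1 / real (Suc n) \<le> 1 / real (Suc N)"
        using that by (auto simp: field_simps)
      then have "1 / real (Suc m) + 1 / real (Suc n) < e / K" using N by simp
      then have "K * (1 / real (Suc m) + 1 / real (Suc n)) < K * (e / K)"
        using K(1) by (intro mult_strict_left_mono) auto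
      then show ?thesis using dist[of m n] K(1) by simp
    qed
    then show "\<exists>N. \<forall>m\<ge>N. \<forall>n\<ge>N. norm (v m - v n) < e" by blast
  qed
  then obtain w where w: "v \<longlonglongrightarrow> w" using convergent_eq_Cauchy by blast
  have "blinfun_apply f w = \<Phi> f" if f: "f \<in> S" for f
  proof (rule LIMSEQ_unique)
    show "(\<lambda>n. f (v n)) \<longlonglongrightarrow> f w" by (intro tendsto_intros w)
    have "(\<lambda>n. f (v n) - \<Phi> f) \<longlonglongrightarrow> 0"
    proof (rule Lim_null_comparison)
      show "\<forall>\<^sub>F n in sequentially. norm (blinfun_apply f (v n) - \<Phi> f) \<le> (1 / real (Suc n)) * norm f"
        using v[OF f] by simp
      show "(\<lambda>n. (1 / real (Suc n)) * norm f) \<longlonglongrightarrow> 0"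
        using tendsto_mult[OF LIMSEQ_Suc[OF lim_1_over_n] tendsto_const[of "norm f"]] by simp
    qed
    then show "(\<lambda>n. f (v n)) \<longlonglongrightarrow> \<Phi> f" by (simp add: LIM_zero_iff)
  qed
  then show ?thesis by blast
qed

end


section \<open>A description of the maximal admissible range without resolvents\<close>

text \<open>
  On the sun dual, \<open>\<psi>\<close> is the image of the embedded vector \<open>x\<close> under the adjoint of the sun generator.
\<close>

definition weakstar_derivative :: "('k::{real_normed_field,euclidean_space} \<Rightarrow> 'a::banach \<Rightarrow> 'a)
    \<Rightarrow> (real \<Rightarrow> 'a \<Rightarrow>\<^sub>L 'a) \<Rightarrow> 'a \<Rightarrow> (('a \<Rightarrow>\<^sub>L 'k) \<Rightarrow> 'k) \<Rightarrow> bool"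
  where "weakstar_derivative sc T x \<psi> \<longleftrightarrow>
    (\<forall>f\<in>sun_dual sc T. ((\<lambda>h. (blinfun_apply f (T h x) - f x) /\<^sub>R h) \<longlongrightarrow> \<psi> f) (at_right 0))"

text \<open>
  This is the sum of the embedded space and its image under the adjoint of the sun generator. Compared with the
  definition by a resolvent there is no spectral parameter, and the adjoint
  generator appears only as a derivative of orbits in the space itself.
\<close>

definition sun_cross :: "('k::{real_normed_field,euclidean_space} \<Rightarrow> 'a::banach \<Rightarrow> 'a)
    \<Rightarrow> (real \<Rightarrow> 'a \<Rightarrow>\<^sub>L 'a) \<Rightarrow> (('a \<Rightarrow>\<^sub>L 'k) \<Rightarrow> 'k) set"
  where "sun_cross sc T = {\<phi> \<in> sun_star_dual sc T.
    \<exists>x y. weakstar_derivative sc T x (\<lambda>f. blinfun_apply f y - \<phi> f)}"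

context c0_semigroup_on
begin

lemma star_add: "\<phi> \<in> dual_of S \<Longrightarrow> f \<in> S \<Longrightarrow> g \<in> S \<Longrightarrow> \<phi> (f + g) = \<phi> f + \<phi> g"
  by (simp add: dual_of_def)

lemma star_scaleR: "\<phi> \<in> dual_of S \<Longrightarrow> f \<in> S \<Longrightarrow> \<phi> (r *\<^sub>R f) = r *\<^sub>R \<phi> f"
  unfolding dual_of_def mem_Collect_eq
  by (metis scale_dual_of_real scaleR_conv_of_real)

lemma star_diff: "\<phi> \<in> dual_of S \<Longrightarrow> f \<in> S \<Longrightarrow> g \<in> S \<Longrightarrow> \<phi> (f - g) = \<phi> f - \<phi> g"
  using star_add[of \<phi> f "(-1) *\<^sub>R g"] star_scaleR[of \<phi> g "-1"] sun_dual_scaleR[of g "-1"] by simp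

lemma star_bounded:
  assumes "\<phi> \<in> dual_of S"
  shows "\<exists>C\<ge>0. \<forall>f\<in>S. norm (\<phi> f) \<le> C * norm f"
proof -
  obtain C where C: "\<And>f. f \<in> S \<Longrightarrow> norm (\<phi> f) \<le> C * norm f"
    using assms unfolding dual_of_def by blast
  have "norm (\<phi> f) \<le> \<bar>C\<bar> * norm f" if "f \<in> S" for f
    by (rule order_trans[OF C[OF that]]) (simp add: mult_right_mono)
  then show ?thesis by (intro exI[of _ "\<bar>C\<bar>"]) auto
qed

lemma dual_of_diff_closed:
  assumes "\<phi> \<in> dual_of S" "\<psi> \<in> dual_of S"
  shows "\<phi> - \<psi> \<in> dual_of S"
proof -
  obtain C D where "\<And>f. f \<in> S \<Longrightarrow> norm (\<phi> f) \<le> C * norm f" "\<And>f. f \<in> S \<Longrightarrow> norm (\<psi> f) \<le> D * norm f"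
    using star_bounded[OF assms(1)] star_bounded[OF assms(2)] by blast
  then have "norm ((\<phi> - \<psi>) f) \<le> (C + D) * norm f" if "f \<in> S" for f
    using norm_triangle_ineq4[of "\<phi> f" "\<psi> f"] that by (fastforce simp: distrib_right)
  then have "\<exists>C. \<forall>f\<in>S. norm ((\<phi> - \<psi>) f) \<le> C * norm f" by blast
  then show ?thesis using assms unfolding dual_of_def by (simp add: right_diff_distrib)
qed

lemma dual_norm_bdd_above:
  assumes "\<phi> \<in> dual_of S"
  shows "bdd_above ((\<lambda>f. norm (\<phi> f)) ` {f \<in> S. norm f \<le> 1})"
proof -
  obtain C where C: "C \<ge> 0" "\<And>f. f \<in> S \<Longrightarrow> norm (\<phi> f) \<le> C * norm f" using star_bounded[OF assms] by blast
  show ?thesis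
  proof (rule bdd_aboveI2[where M = C])
    fix f assume "f \<in> {f \<in> S. norm f \<le> 1}"
    then show "norm (\<phi> f) \<le> C"
      using C(2)[of f] mult_left_mono[of "norm f" 1 C] C(1) by simp
  qed
qed

lemma dual_norm_nonneg:
  assumes "\<phi> \<in> dual_of S"
  shows "0 \<le> dual_norm S \<phi>"
proof -
  have "norm (\<phi> 0) \<le> dual_norm S \<phi>"
    unfolding dual_norm_def by (rule cSUP_upper[OF _ dual_norm_bdd_above[OF assms]]) simp
  then show ?thesis using norm_ge_zero order_trans by blast
qed

lemma norm_le_dual_norm:
  assumes \<phi>: "\<phi> \<in> dual_of S" and f: "f \<in> S"
  shows "norm (\<phi> f) \<le> dual_norm S \<phi> * norm f"
proof (cases "f = 0")
  case True
  then show ?thesis using star_scaleR[OF \<phi> f, of 0] by simp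
next
  case False
  have "norm (\<phi> ((1 / norm f) *\<^sub>R f)) \<le> dual_norm S \<phi>"
    unfolding dual_norm_def using f False
    by (intro cSUP_upper dual_norm_bdd_above \<phi>) (auto intro: sun_dual_scaleR)
  then show ?thesis using False star_scaleR[OF \<phi> f] by (simp add: divide_le_eq)
qed

text \<open>
  Elements of \<open>dual_of S\<close> vanish outside \<open>S\<close> and are continuous only along \<open>S\<close>.
\<close>

lemma star_tendsto:
  assumes \<phi>: "\<phi> \<in> dual_of S" and g: "(g \<longlongrightarrow> l) F" and mem: "\<forall>\<^sub>F h in F. g h \<in> S" and l: "l \<in> S"
  shows "((\<lambda>h. \<phi> (g h)) \<longlongrightarrow> \<phi> l) F"
proof -
  obtain C where C: "C \<ge> 0" "\<And>f. f \<in> S \<Longrightarrow> norm (\<phi> f) \<le> C * norm f" using star_bounded[OF \<phi>] by blast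
  have "((\<lambda>h. \<phi> (g h) - \<phi> l) \<longlongrightarrow> 0) F"
  proof (rule Lim_null_comparison)
    show "\<forall>\<^sub>F h in F. norm (\<phi> (g h) - \<phi> l) \<le> C * norm (g h - l)"
      using mem by eventually_elim (use l C(2) star_diff[OF \<phi>] sun_dual_diff in metis)
    show "((\<lambda>h. C * norm (g h - l)) \<longlongrightarrow> 0) F"
      using tendsto_mult_right_zero[OF tendsto_norm_zero[OF LIM_zero[OF g]]] .
  qed
  then show ?thesis by (simp add: LIM_zero_iff)
qed

lemma star_average:
  assumes \<phi>: "\<phi> \<in> dual_of S" and f: "f \<in> S"
  shows "((\<lambda>h. \<phi> (f o\<^sub>L orbit_integral h) /\<^sub>R h) \<longlongrightarrow> \<phi> f) (at_right 0)"
proof -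
  have mem: "f o\<^sub>L orbit_integral h \<in> S" if "h > 0" for h
    using sun_dual_orbit_integral[of f h] f that by (simp add: in_sun_dual_iff)
  have "((\<lambda>h. \<phi> ((f o\<^sub>L orbit_integral h) /\<^sub>R h)) \<longlongrightarrow> \<phi> f) (at_right 0)"
  proof (rule star_tendsto[OF \<phi> adjoint_orbit_integral_average[OF f] _ f])
    show "\<forall>\<^sub>F h in at_right 0. (f o\<^sub>L orbit_integral h) /\<^sub>R h \<in> S"
      using eventually_at_right_less by eventually_elim (use mem in \<open>simp add: sun_dual_scaleR\<close>)
  qed
  then show ?thesis
    by (rule Lim_transform_eventually)
      (use eventually_at_right_less in \<open>eventually_elim, simp add: star_scaleR \<phi> mem\<close>)
qed

text \<open>
  A bounded functional on \<open>S\<close> need not extend to a bounded linear map on the type of all functionals, so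
  integration in the dual and application of \<open>\<phi>\<close> are interchanged by the fundamental theorem of calculus.
\<close>

lemma star_orbit_has_integral:
  assumes \<phi>: "\<phi> \<in> dual_of S" and f: "f \<in> S" and ab: "0 \<le> a" "a \<le> b"
  shows "((\<lambda>s. \<phi> (f o\<^sub>L T s)) has_integral
    \<phi> (f o\<^sub>L orbit_integral b) - \<phi> (f o\<^sub>L orbit_integral a)) {a..b}"
proof (rule fundamental_theorem_of_calculus[OF ab(2)])
  fix t assume t: "t \<in> {a..b}"
  let ?F = "\<lambda>t. f o\<^sub>L orbit_integral t"
  have mem: "?F s \<in> S" if "s \<ge> 0" for s
    using sun_dual_orbit_integral[of f s] f that by (simp add: in_sun_dual_iff)
  have "((\<lambda>s. integral {0..s} (\<lambda>s. f o\<^sub>L T s)) has_vector_derivative (f o\<^sub>L T t)) (at t within {0..b})"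
    using t ab by (intro integral_has_vector_derivative adjoint_orbit_continuous_on f) auto
  then have "((\<lambda>s. integral {0..s} (\<lambda>s. f o\<^sub>L T s)) has_vector_derivative (f o\<^sub>L T t)) (at t within {a..b})"
    using ab by (rule_tac has_vector_derivative_within_subset) auto
  then have "(?F has_vector_derivative (f o\<^sub>L T t)) (at t within {a..b})"
    using t ab by (rule_tac has_vector_derivative_transform[of t "{a..b}" ?F])
      (auto simp: adjoint_orbit_integral f)
  then have *: "((\<lambda>s. (1 / norm (s - t)) *\<^sub>R (?F s - (?F t + (s - t) *\<^sub>R (f o\<^sub>L T t)))) \<longlongrightarrow> 0) (at t within {a..b})"
    by (simp add: has_vector_derivative_def has_derivative_within)
  have z: "\<phi> 0 = 0" using star_scaleR[OF \<phi> sun_dual_zero, of 0] by simp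
  have mT: "f o\<^sub>L T t \<in> S" using t ab by (intro sun_dual_T f) auto
  have "((\<lambda>s. \<phi> ((1 / norm (s - t)) *\<^sub>R (?F s - (?F t + (s - t) *\<^sub>R (f o\<^sub>L T t))))) \<longlongrightarrow> \<phi> 0) (at t within {a..b})"
  proof (rule star_tendsto[OF \<phi> *])
    show "\<forall>\<^sub>F s in at t within {a..b}. (1 / norm (s - t)) *\<^sub>R (?F s - (?F t + (s - t) *\<^sub>R (f o\<^sub>L T t))) \<in> S"
      using t ab mem mT unfolding eventually_at_filter
      by (auto intro!: always_eventually sun_dual_scaleR sun_dual_diff sun_dual_add)
  qed simp
  then have "((\<lambda>s. (1 / norm (s - t)) *\<^sub>R (\<phi> (?F s) - (\<phi> (?F t) + (s - t) *\<^sub>R \<phi> (f o\<^sub>L T t)))) \<longlongrightarrow> \<phi> 0) (at t within {a..b})"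
  proof (rule Lim_transform_eventually)
    show "\<forall>\<^sub>F s in at t within {a..b}. \<phi> ((1 / norm (s - t)) *\<^sub>R (?F s - (?F t + (s - t) *\<^sub>R (f o\<^sub>L T t))))
        = (1 / norm (s - t)) *\<^sub>R (\<phi> (?F s) - (\<phi> (?F t) + (s - t) *\<^sub>R \<phi> (f o\<^sub>L T t)))"
      unfolding eventually_at_filter using t ab mem mT
      by (auto intro!: always_eventually simp: star_scaleR[OF \<phi>] star_diff[OF \<phi>] star_add[OF \<phi>]
          sun_dual_scaleR sun_dual_diff sun_dual_add)
  qed
  then show "((\<lambda>t. \<phi> (?F t)) has_vector_derivative \<phi> (f o\<^sub>L T t)) (at t within {a..b})"
    by (simp add: z has_vector_derivative_def has_derivative_within bounded_linear_scaleR_left)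
qed

lemma star_convolution_has_integral:
  assumes \<phi>: "\<phi> \<in> dual_of S" and f: "f \<in> S" and ab: "a \<le> b" "b \<le> t"
  shows "((\<lambda>\<tau>. \<phi> (f o\<^sub>L T (t - \<tau>))) has_integral
    \<phi> (f o\<^sub>L orbit_integral (t - a)) - \<phi> (f o\<^sub>L orbit_integral (t - b))) {a..b}"
proof -
  have "((\<lambda>s. \<phi> (f o\<^sub>L T s)) has_integral
    \<phi> (f o\<^sub>L orbit_integral (t - a)) - \<phi> (f o\<^sub>L orbit_integral (t - b))) {t - b..t - a}"
    using ab by (intro star_orbit_has_integral \<phi> f) auto
  then have "((\<lambda>s. \<phi> (f o\<^sub>L T (- s))) has_integral
    \<phi> (f o\<^sub>L orbit_integral (t - a)) - \<phi> (f o\<^sub>L orbit_integral (t - b))) {a - t..b - t}"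
    using has_integral_reflect_real[where f = "\<lambda>s. \<phi> (f o\<^sub>L T s)" and a = "t - b" and b = "t - a"] by simp
  from has_integral_shift_real_ivl[OF this, of "- t"] show ?thesis by simp
qed

text \<open>
  Applied to \<open>f o\<^sub>L orbit_integral t\<close>, the derivative can be computed in a second way by
  \<open>orbit_integral_exchange\<close>.
\<close>

lemma weakstar_derivative_integral:
  assumes "weakstar_derivative sc T x \<psi>" "f \<in> S" "t \<ge> 0"
  shows "\<psi> (f o\<^sub>L orbit_integral t) = f (T t x) - f x"
proof (rule tendsto_unique[OF trivial_limit_at_right_real])
  have "f o\<^sub>L orbit_integral t \<in> S"
    using sun_dual_orbit_integral[of f t] assms by (simp add: in_sun_dual_iff)
  then show "((\<lambda>h. f (orbit_integral t (T h x - x)) /\<^sub>R h) \<longlongrightarrow> \<psi> (f o\<^sub>L orbit_integral t)) (at_right 0)"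
    using assms(1) by (auto simp: weakstar_derivative_def blinfun.diff_right)
  have "((\<lambda>h. f (orbit_integral h (T t x - x) /\<^sub>R h)) \<longlongrightarrow> f (T t x - x)) (at_right 0)"
    by (intro tendsto_intros orbit_integral_average)
  then show "((\<lambda>h. f (orbit_integral t (T h x - x)) /\<^sub>R h) \<longlongrightarrow> f (T t x) - f x) (at_right 0)"
    unfolding blinfun.diff_right[of f "T t x" x]
    by (rule Lim_transform_eventually)
      (use eventually_at_right_less in
        \<open>eventually_elim, simp add: orbit_integral_exchange(2) assms blinfun.scaleR_right\<close>)
qed

lemma sun_cross_integral:
  assumes "\<phi> \<in> sun_cross sc T" "t \<ge> 0"
  shows "\<exists>v. \<forall>f\<in>S. blinfun_apply f v = \<phi> (f o\<^sub>L orbit_integral t)"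
proof -
  obtain x y where xy: "weakstar_derivative sc T x (\<lambda>f. blinfun_apply f y - \<phi> f)"
    using assms(1) by (auto simp: sun_cross_def)
  have "f (orbit_integral t y - (T t x - x)) = \<phi> (f o\<^sub>L orbit_integral t)" if "f \<in> S" for f
    by (simp add: blinfun.diff_right flip: weakstar_derivative_integral[OF xy that assms(2)])
  then show ?thesis by blast
qed

text \<open>
  If \<open>v t\<close> represents the integral of the orbit of \<open>\<phi>\<close> over \<open>{0..t}\<close>, then the orbit of the integral \<open>x\<close>
  of \<open>v\<close> over \<open>{0..d}\<close> has the weak-star derivative \<open>j (v d) - d *\<^sub>R \<phi>\<close> at \<open>0\<close>. The function \<open>v\<close>
  is Lipschitz, hence integrable, because the sun dual norms the space.
\<close>

lemma sun_crossI:
  assumes \<phi>: "\<phi> \<in> dual_of S" and d: "d > 0"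
    and v: "\<And>t. t \<in> {0..d} \<Longrightarrow> \<exists>v. \<forall>f\<in>S. blinfun_apply f v = \<phi> (f o\<^sub>L orbit_integral t)"
  shows "\<phi> \<in> sun_cross sc T"
proof -
  obtain v where v: "\<And>t f. t \<in> {0..d} \<Longrightarrow> f \<in> S \<Longrightarrow> blinfun_apply f (v t) = \<phi> (f o\<^sub>L orbit_integral t)"
    using v by metis
  obtain M where M: "M \<ge> 1" "\<And>s. s \<in> {0..d} \<Longrightarrow> norm (T s) \<le> M" using T_bounded by blast
  obtain K where K: "K > 0" "\<And>x B. B \<ge> 0 \<Longrightarrow> (\<And>f. f \<in> S \<Longrightarrow> norm (blinfun_apply f x) \<le> B * norm f) \<Longrightarrow> norm x \<le> K * B"
    using sun_dual_norming by blast
  obtain C where C: "C \<ge> 0" "\<And>f. f \<in> S \<Longrightarrow> norm (\<phi> f) \<le> C * norm f" using star_bounded[OF \<phi>] by blast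
  have mem: "f o\<^sub>L orbit_integral t \<in> S" if "f \<in> S" "t \<ge> 0" for f t
    using sun_dual_orbit_integral[of f t] that by (simp add: in_sun_dual_iff)
  have lip: "norm (v t - v s) \<le> K * (C * (M * M)) * (t - s)" if st: "0 \<le> s" "s \<le> t" "t \<le> d" for s t
  proof -
    have "norm (v t - v s) \<le> K * (C * (M * M) * (t - s))"
    proof (rule K(2))
      show "0 \<le> C * (M * M) * (t - s)" using C(1) M(1) st by simp
      fix f assume f: "f \<in> S"
      have eq: "(f o\<^sub>L orbit_integral t) - (f o\<^sub>L orbit_integral s) = f o\<^sub>L (T s o\<^sub>L orbit_integral (t - s))"
        using orbit_integral_T(2)[of s "t - s"] st
        by (intro blinfun_eqI) (simp add: blinfun.diff_left blinfun.diff_right)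
      have "norm (T s o\<^sub>L orbit_integral (t - s)) \<le> norm (T s) * norm (orbit_integral (t - s))"
        by (rule norm_blinfun_compose)
      also have "\<dots> \<le> M * (M * (t - s))"
        using M st norm_orbit_integral[of d M "t - s"] by (intro mult_mono) auto
      finally have "norm ((f o\<^sub>L orbit_integral t) - (f o\<^sub>L orbit_integral s)) \<le> (M * (M * (t - s))) * norm f"
        unfolding eq by (rule norm_adjoint_le)
      then have "C * norm ((f o\<^sub>L orbit_integral t) - (f o\<^sub>L orbit_integral s)) \<le> C * ((M * (M * (t - s))) * norm f)"
        using C(1) by (rule mult_left_mono)
      moreover have "norm (f (v t - v s)) \<le> C * norm ((f o\<^sub>L orbit_integral t) - (f o\<^sub>L orbit_integral s))"
        using C(2)[OF sun_dual_diff[OF mem[OF f, of t] mem[OF f, of s]]] st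
        by (simp add: blinfun.diff_right v[OF _ f] star_diff[OF \<phi> mem[OF f] mem[OF f]])
      ultimately show "norm (f (v t - v s)) \<le> C * (M * M) * (t - s) * norm f" by (simp add: mult_ac)
    qed
    then show ?thesis by (simp add: mult_ac)
  qed
  have "(K * (C * (M * M)))-lipschitz_on {0..d} v"
  proof (rule lipschitz_onI)
    fix s t assume "s \<in> {0..d}" "t \<in> {0..d}"
    then show "dist (v s) (v t) \<le> K * (C * (M * M)) * dist s t"
      using lip[of s t] lip[of t s] by (cases "s \<le> t") (auto simp: dist_norm norm_minus_commute)
  qed (use K(1) C(1) M(1) in simp)
  then have "continuous_on {0..d} v" by (rule lipschitz_on_continuous_on)
  then have int: "v integrable_on {0..d}" by (rule integrable_continuous_interval)
  define x where "x = integral {0..d} v"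
  have fx: "blinfun_apply f x = integral {0..d} (\<lambda>t. f (v t))" for f :: "'a \<Rightarrow>\<^sub>L 'k"
    unfolding x_def using integral_linear[OF int blinfun.bounded_linear_right[of f]] by (simp add: o_def)
  \<comment> \<open>Two exchanges of integrations: \<open>h\<close> and \<open>t\<close> trade places, and then \<open>v h\<close>, of which only pairings with
    elements of \<open>S\<close> are known, is integrated along its own orbit.\<close>
  have key: "f (T h x) - f x = \<phi> (((f o\<^sub>L orbit_integral d) - d *\<^sub>R f) o\<^sub>L orbit_integral h)"
    if f: "f \<in> S" and h: "h \<in> {0<..d}" for f h
  proof -
    let ?g = "(f o\<^sub>L T h) - f"
    have gS: "?g \<in> S" using f h by (intro sun_dual_diff sun_dual_T) auto
    have "f (T h x) - f x = ?g x" by (simp add: blinfun.diff_left)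
    also have "\<dots> = integral {0..d} (\<lambda>t. ?g (v t))" by (rule fx)
    also have "\<dots> = integral {0..d} (\<lambda>t. f (T t (v h)) - f (v h))"
    proof (rule integral_cong)
      fix t assume t: "t \<in> {0..d}"
      let ?k = "(f o\<^sub>L T t) - f"
      have kS: "?k \<in> S" using f t by (intro sun_dual_diff sun_dual_T) auto
      have "?g o\<^sub>L orbit_integral t = ?k o\<^sub>L orbit_integral h"
      proof (rule blinfun_eqI)
        fix z
        show "blinfun_apply (?g o\<^sub>L orbit_integral t) z = blinfun_apply (?k o\<^sub>L orbit_integral h) z"
          using orbit_integral_T(2)[of h t z] orbit_integral_T(2)[of t h z] h t
          by (simp add: blinfun.diff_left blinfun.diff_right add.commute)
      qed
      then have "?g (v t) = ?k (v h)" using v[OF t gS] v[of h ?k] kS h by simp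
      then show "?g (v t) = f (T t (v h)) - f (v h)" by (simp add: blinfun.diff_left)
    qed
    also have "\<dots> = f (orbit_integral d (v h)) - d *\<^sub>R f (v h)"
      using integral_linear[OF orbit_integrable[of 0 "v h" d] blinfun.bounded_linear_right[of f]] d
        integrable_linear[OF orbit_integrable[of 0 "v h" d] blinfun.bounded_linear_right[of f]]
      by (subst integral_diff) (simp_all add: o_def orbit_integral_apply integrable_const_ivl)
    also have "\<dots> = ((f o\<^sub>L orbit_integral d) - d *\<^sub>R f) (v h)"
      by (simp add: blinfun.diff_left blinfun.scaleR_left)
    also have "\<dots> = \<phi> (((f o\<^sub>L orbit_integral d) - d *\<^sub>R f) o\<^sub>L orbit_integral h)"
      using h d f by (intro v sun_dual_diff sun_dual_scaleR mem) auto
    finally show ?thesis .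
  qed
  have "weakstar_derivative sc T (x /\<^sub>R d) (\<lambda>f. blinfun_apply f (v d /\<^sub>R d) - \<phi> f)"
    unfolding weakstar_derivative_def
  proof
    fix f assume f: "f \<in> S"
    let ?k = "(f o\<^sub>L orbit_integral d) - d *\<^sub>R f"
    have kS: "?k \<in> S" using f d by (intro sun_dual_diff sun_dual_scaleR mem) auto
    have "\<phi> ?k = f (v d) - d *\<^sub>R \<phi> f"
      using f d by (subst star_diff[OF \<phi>]) (auto simp: mem sun_dual_scaleR v star_scaleR[OF \<phi>])
    then have eq: "\<phi> ?k /\<^sub>R d = f (v d /\<^sub>R d) - \<phi> f"
      using d by (simp add: blinfun.scaleR_right scaleR_diff_right)
    have "((\<lambda>h. (\<phi> (?k o\<^sub>L orbit_integral h) /\<^sub>R h) /\<^sub>R d) \<longlongrightarrow> \<phi> ?k /\<^sub>R d) (at_right 0)"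
      by (intro tendsto_intros star_average[OF \<phi> kS])
    then show "((\<lambda>h. (f (T h (x /\<^sub>R d)) - f (x /\<^sub>R d)) /\<^sub>R h) \<longlongrightarrow> f (v d /\<^sub>R d) - \<phi> f) (at_right 0)"
      unfolding eq
    proof (rule Lim_transform_eventually)
      show "\<forall>\<^sub>F h in at_right 0. \<phi> (?k o\<^sub>L orbit_integral h) /\<^sub>R h /\<^sub>R d
          = (f (T h (x /\<^sub>R d)) - f (x /\<^sub>R d)) /\<^sub>R h"
        using eventually_at_right_real[OF d]
      proof eventually_elim
        case (elim h)
        then have "\<phi> (?k o\<^sub>L orbit_integral h) = f (T h x) - f x" using key[OF f, of h] by simp
        then show ?case by (simp add: blinfun.scaleR_right scaleR_diff_right mult.commute)
      qed
    qed
  qed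
  then show ?thesis using \<phi> unfolding sun_cross_def sun_star_dual_def by blast
qed

lemma sun_cross_diff:
  assumes "\<phi> \<in> sun_cross sc T" "\<psi> \<in> sun_cross sc T"
  shows "\<phi> - \<psi> \<in> sun_cross sc T"
proof -
  have \<phi>\<psi>: "\<phi> \<in> dual_of S" "\<psi> \<in> dual_of S"
    using assms by (auto simp: sun_cross_def sun_star_dual_def)
  show ?thesis
  proof (rule sun_crossI[OF dual_of_diff_closed[OF \<phi>\<psi>] zero_less_one])
    fix t :: real assume "t \<in> {0..1}"
    then obtain v w where "\<forall>f\<in>S. blinfun_apply f v = \<phi> (f o\<^sub>L orbit_integral t)"
      "\<forall>f\<in>S. blinfun_apply f w = \<psi> (f o\<^sub>L orbit_integral t)"
      using sun_cross_integral assms by (metis atLeastAtMost_iff)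
    then show "\<exists>v. \<forall>f\<in>S. blinfun_apply f v = (\<phi> - \<psi>) (f o\<^sub>L orbit_integral t)"
      by (intro exI[of _ "v - w"]) (simp add: blinfun.diff_right)
  qed
qed

lemma sun_cross_add:
  assumes "\<phi> \<in> sun_cross sc T" "\<psi> \<in> sun_cross sc T"
  shows "\<phi> + \<psi> \<in> sun_cross sc T"
  using sun_cross_diff[OF assms(1) sun_cross_diff[OF sun_cross_diff[OF assms(2,2)] assms(2)]] by simp

end


section \<open>Admissible ranges\<close>

context c0_semigroup_on
begin

lemma star_pairing_continuous:
  assumes q: "norm_continuous_on S A q" "\<And>t. t \<in> A \<Longrightarrow> q t \<in> dual_of S"
    and g: "continuous_on A g" "\<And>t. t \<in> A \<Longrightarrow> g t \<in> S"
  shows "continuous_on A (\<lambda>t. q t (g t))"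
  unfolding continuous_on_def
proof
  fix t assume t: "t \<in> A"
  have gt: "(g \<longlongrightarrow> g t) (at t within A)" using g(1) t by (simp add: continuous_on_def)
  have memA: "\<forall>\<^sub>F s in at t within A. s \<in> A" by (simp add: eventually_at_filter)
  have "((\<lambda>s. q s (g s) - q t (g s)) \<longlongrightarrow> 0) (at t within A)"
  proof (rule Lim_null_comparison)
    show "\<forall>\<^sub>F s in at t within A. norm (q s (g s) - q t (g s)) \<le> dual_norm S (q s - q t) * norm (g s)"
      using memA
    proof eventually_elim
      case (elim s)
      then show ?case
        using norm_le_dual_norm[OF dual_of_diff_closed[OF q(2)[OF elim] q(2)[OF t]] g(2)[OF elim]] by simp
    qed
    have "((\<lambda>s. dual_norm S (q s - q t)) \<longlongrightarrow> 0) (at t within A)"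
      using q(1) t by (simp add: norm_continuous_on_def)
    from tendsto_mult[OF this tendsto_norm[OF gt]]
    show "((\<lambda>s. dual_norm S (q s - q t) * norm (g s)) \<longlongrightarrow> 0) (at t within A)" by simp
  qed
  moreover have "((\<lambda>s. q t (g s)) \<longlongrightarrow> q t (g t)) (at t within A)"
    using memA g(2) t by (intro star_tendsto q(2) gt) (auto elim: eventually_mono)
  ultimately have "((\<lambda>s. (q s (g s) - q t (g s)) + q t (g s)) \<longlongrightarrow> 0 + q t (g t)) (at t within A)"
    by (rule tendsto_add)
  then show "((\<lambda>s. q s (g s)) \<longlongrightarrow> q t (g t)) (at t within A)" by simp
qed

lemma adjoint_convolution_continuous_on:
  assumes f: "f \<in> S" and A: "A \<subseteq> {..t}"
  shows "continuous_on A (\<lambda>\<tau>. f o\<^sub>L T (t - \<tau>))"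
  by (rule continuous_on_compose2[OF adjoint_orbit_continuous[OF f], of A "\<lambda>\<tau>. t - \<tau>"])
    (use A in \<open>auto intro!: continuous_intros\<close>)

lemma sun_star_semigroup_apply:
  "f \<in> S \<Longrightarrow> sun_star_semigroup sc T t \<phi> f = \<phi> (f o\<^sub>L T t)"
  by (simp add: sun_star_semigroup_def adjoint_semigroup_def)

lemma in_range_embedding_iff:
  "weakstar_integral S a b q \<in> range (sun_embedding sc T) \<longleftrightarrow>
    (\<exists>v. \<forall>f\<in>S. blinfun_apply f v = integral {a..b} (\<lambda>\<tau>. q \<tau> f))"
proof -
  have "weakstar_integral S a b q = sun_embedding sc T v \<longleftrightarrow>
      (\<forall>f\<in>S. blinfun_apply f v = integral {a..b} (\<lambda>\<tau>. q \<tau> f))" for v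
    unfolding weakstar_integral_def sun_embedding_def fun_eq_iff Ball_def
    by (rule all_cong1) auto
  then show ?thesis by (simp add: image_iff)
qed

text \<open>
  The weak-star integral is zero off the sun dual by definition, so only its values on the sun dual matter.
\<close>

lemma convolution_in_range_iff:
  "weakstar_integral S a b (\<lambda>\<tau>. sun_star_semigroup sc T (t - \<tau>) (q \<tau>)) \<in> range (sun_embedding sc T) \<longleftrightarrow>
    (\<exists>v. \<forall>f\<in>S. blinfun_apply f v = integral {a..b} (\<lambda>\<tau>. q \<tau> (f o\<^sub>L T (t - \<tau>))))"
  unfolding in_range_embedding_iff by (simp add: sun_star_semigroup_apply)

lemma dual_norm_zero: "dual_norm S 0 = 0"
proof -
  have "{f \<in> S. norm f \<le> 1} \<noteq> {}" using sun_dual_zero by fastforce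
  then show ?thesis by (simp add: dual_norm_def)
qed

text \<open>
  A constant function on the interval provided by the definition is enough.
\<close>

lemma admissible_range_subset_sun_cross:
  assumes adm: "admissible_range sc T M"
  shows "M \<subseteq> sun_cross sc T"
proof
  fix \<phi> assume \<phi>M: "\<phi> \<in> M"
  then have \<phi>: "\<phi> \<in> dual_of S" using adm by (auto simp: admissible_range_def closed_subspace_dual_def)
  obtain J a b where J: "is_interval J" "a \<in> J" "b \<in> J" "a < b"
    and JM: "\<And>q. (\<forall>t\<in>J. q t \<in> M) \<and> norm_continuous_on S J q \<Longrightarrow> \<forall>s\<in>J. \<forall>t\<in>J. s \<le> t \<longrightarrow>
          weakstar_integral S s t (\<lambda>\<tau>. sun_star_semigroup sc T (t - \<tau>) (q \<tau>)) \<in> range (sun_embedding sc T)"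
    using adm unfolding admissible_range_def by blast
  show "\<phi> \<in> sun_cross sc T"
  proof (rule sun_crossI[OF \<phi>])
    show "b - a > 0" using J by simp
    fix t assume t: "t \<in> {0..b - a}"
    then have atJ: "a + t \<in> J" using J(1,2,3) mem_is_interval_1_I[of J a b "a + t"] by simp
    have "(\<forall>t\<in>J. \<phi> \<in> M) \<and> norm_continuous_on S J (\<lambda>_. \<phi>)"
      using \<phi>M by (simp add: norm_continuous_on_def dual_norm_zero)
    from JM[OF this, THEN bspec, OF J(2), THEN bspec, OF atJ, THEN mp]
    obtain v where v: "\<forall>f\<in>S. blinfun_apply f v = integral {a..a + t} (\<lambda>\<tau>. \<phi> (f o\<^sub>L T (a + t - \<tau>)))"
      unfolding convolution_in_range_iff using t by auto
    have "blinfun_apply f v = \<phi> (f o\<^sub>L orbit_integral t)" if f: "f \<in> S" for f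
    proof -
      have "\<phi> 0 = 0" using star_scaleR[OF \<phi> sun_dual_zero, of 0] by simp
      then have "((\<lambda>\<tau>. \<phi> (f o\<^sub>L T (a + t - \<tau>))) has_integral \<phi> (f o\<^sub>L orbit_integral t)) {a..a + t}"
        using star_convolution_has_integral[OF \<phi> f, of a "a + t" "a + t"] t by simp
      from integral_unique[OF this] show ?thesis using v f by simp
    qed
    then show "\<exists>v. \<forall>f\<in>S. blinfun_apply f v = \<phi> (f o\<^sub>L orbit_integral t)" by blast
  qed
qed

text \<open>
  A bisection argument takes the place of an explicit approximation by step functions. On a short interval \<open>q\<close> is
  almost constant, and for a constant value the integral is in the range of the embedding by
  \<open>sun_cross_integral\<close>; the errors are proportional to the lengths of the intervals and add up.
\<close>

lemma sun_cross_convolution: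
  assumes q: "\<And>\<tau>. \<tau> \<in> {0..1} \<Longrightarrow> q \<tau> \<in> sun_cross sc T" "norm_continuous_on S {0..1} q"
    and st: "0 \<le> s" "s \<le> t" "t \<le> 1"
  shows "\<exists>v. \<forall>f\<in>S. blinfun_apply f v = integral {s..t} (\<lambda>\<tau>. q \<tau> (f o\<^sub>L T (t - \<tau>)))"
proof (rule embedding_range_closed)
  fix e :: real assume e: "e > 0"
  obtain M where M: "M \<ge> 1" "\<And>s. s \<in> {0..1} \<Longrightarrow> norm (T s) \<le> M" using T_bounded by blast
  have qS: "q \<tau> \<in> dual_of S" if "\<tau> \<in> {0..1}" for \<tau>
    using q(1)[OF that] by (auto simp: sun_cross_def sun_star_dual_def)
  have qc: "norm_continuous_on S {a..b} q" if "{a..b} \<subseteq> {0..1}" for a b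
    using q(2) that unfolding norm_continuous_on_def by (blast intro: tendsto_within_subset)
  have cont: "continuous_on {a..b} (\<lambda>\<tau>. q \<tau> (f o\<^sub>L T (t - \<tau>)))"
    if "f \<in> S" "s \<le> a" "b \<le> t" for f a b
    using that st by (intro star_pairing_continuous qc qS adjoint_convolution_continuous_on sun_dual_T) auto
  have "s \<le> s \<and> t \<le> t \<longrightarrow> (\<exists>v. \<forall>f\<in>S. norm (blinfun_apply f v -
      integral {s..t} (\<lambda>\<tau>. q \<tau> (f o\<^sub>L T (t - \<tau>)))) \<le> e * (t - s) * norm f)"
  proof (rule Bolzano[where a = s and b = t and P = "\<lambda>a b. s \<le> a \<and> b \<le> t \<longrightarrow> (\<exists>v. \<forall>f\<in>S. norm (blinfun_apply f v -
      integral {a..b} (\<lambda>\<tau>. q \<tau> (f o\<^sub>L T (t - \<tau>)))) \<le> e * (b - a) * norm f)"],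
      goal_cases le trans local)
    case le
    show ?case by (rule st(2))
  next
    case (trans a b c)
    show ?case
    proof
      assume ac: "s \<le> a \<and> c \<le> t"
      let ?I = "\<lambda>a b f. integral {a..b} (\<lambda>\<tau>. q \<tau> (f o\<^sub>L T (t - \<tau>)))"
      have "s \<le> a \<and> b \<le> t" "s \<le> b \<and> c \<le> t" using trans(3,4) ac by auto
      note IH = trans(1)[THEN mp, OF this(1)] trans(2)[THEN mp, OF this(2)]
      obtain v where v: "\<And>f. f \<in> S \<Longrightarrow> norm (blinfun_apply f v - ?I a b f) \<le> e * (b - a) * norm f"
        using IH(1) by blast
      obtain w where w: "\<And>f. f \<in> S \<Longrightarrow> norm (blinfun_apply f w - ?I b c f) \<le> e * (c - b) * norm f"
        using IH(2) by blast
      have "norm (blinfun_apply f (v + w) - ?I a c f) \<le> e * (c - a) * norm f" if f: "f \<in> S" for f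
      proof -
        have comb: "?I a b f + ?I b c f = ?I a c f"
          using cont[OF f, of a c] ac trans
          by (intro Henstock_Kurzweil_Integration.integral_combine integrable_continuous_interval) auto
        then have "blinfun_apply f (v + w) - ?I a c f = (f v - ?I a b f) + (f w - ?I b c f)"
          unfolding comb[symmetric] blinfun.add_right by (simp only: add_diff_add)
        then have "norm (blinfun_apply f (v + w) - ?I a c f) \<le> e * (b - a) * norm f + e * (c - b) * norm f"
          using norm_triangle_ineq[of "f v - ?I a b f" "f w - ?I b c f"] v[OF f] w[OF f] by simp
        then show ?thesis by (simp add: algebra_simps)
      qed
      then show "\<exists>v. \<forall>f\<in>S. norm (blinfun_apply f v - ?I a c f) \<le> e * (c - a) * norm f" by blast
    qed
  next
    case (local x)
    then have x: "x \<in> {0..1}" using st by auto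
    have "((\<lambda>\<tau>. dual_norm S (q \<tau> - q x)) \<longlongrightarrow> 0) (at x within {0..1})"
      using q(2) x by (simp add: norm_continuous_on_def)
    moreover have "e / M > 0" using e M(1) by simp
    ultimately have "\<forall>\<^sub>F \<tau> in at x within {0..1}. dist (dual_norm S (q \<tau> - q x)) 0 < e / M"
      by (rule tendstoD)
    then obtain d where d: "d > 0"
      and qd: "\<And>\<tau>. \<tau> \<in> {0..1} \<Longrightarrow> \<tau> \<noteq> x \<Longrightarrow> \<bar>\<tau> - x\<bar> < d \<Longrightarrow> \<bar>dual_norm S (q \<tau> - q x)\<bar> < e / M"
      unfolding eventually_at dist_real_def by force
    have qd: "dual_norm S (q \<tau> - q x) \<le> e / M" if "\<tau> \<in> {0..1}" "\<bar>\<tau> - x\<bar> < d" for \<tau>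
      using qd[of \<tau>] that e M(1) by (cases "\<tau> = x") (auto simp: dual_norm_zero)
    have "\<exists>v. \<forall>f\<in>S. norm (blinfun_apply f v -
        integral {a..b} (\<lambda>\<tau>. q \<tau> (f o\<^sub>L T (t - \<tau>)))) \<le> e * (b - a) * norm f"
      if ab: "a \<le> x" "x \<le> b" "b - a < d" "s \<le> a" "b \<le> t" for a b
    proof -
      obtain v w where v: "\<And>f. f \<in> S \<Longrightarrow> blinfun_apply f v = q x (f o\<^sub>L orbit_integral (t - a))"
        and w: "\<And>f. f \<in> S \<Longrightarrow> blinfun_apply f w = q x (f o\<^sub>L orbit_integral (t - b))"
        using sun_cross_integral[OF q(1)[OF x], of "t - a"] sun_cross_integral[OF q(1)[OF x], of "t - b"] ab
        by auto
      have "norm (blinfun_apply f (v - w) - integral {a..b} (\<lambda>\<tau>. q \<tau> (f o\<^sub>L T (t - \<tau>))))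
          \<le> e * (b - a) * norm f" if f: "f \<in> S" for f
      proof -
        let ?k = "\<lambda>\<tau>. q \<tau> (f o\<^sub>L T (t - \<tau>)) - q x (f o\<^sub>L T (t - \<tau>))"
        have x_int: "((\<lambda>\<tau>. q x (f o\<^sub>L T (t - \<tau>))) has_integral blinfun_apply f (v - w)) {a..b}"
          using star_convolution_has_integral[OF qS[OF x] f, of a b t] ab
          by (simp add: blinfun.diff_right v[OF f] w[OF f])
        have kc: "continuous_on {a..b} ?k"
          using ab x st f qS[OF x]
          by (intro continuous_on_diff cont star_pairing_continuous adjoint_convolution_continuous_on sun_dual_T)
            (auto simp: norm_continuous_on_def dual_norm_zero)
        have "norm (?k \<tau>) \<le> e * norm f" if \<tau>: "\<tau> \<in> {a..b}" for \<tau>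
        proof -
          have \<tau>': "\<tau> \<in> {0..1}" "\<bar>\<tau> - x\<bar> < d" "\<tau> \<le> t" "t - \<tau> \<in> {0..1}" using \<tau> ab st by auto
          have gS: "f o\<^sub>L T (t - \<tau>) \<in> S" using f \<tau>' by (intro sun_dual_T) auto
          have "norm (?k \<tau>) \<le> dual_norm S (q \<tau> - q x) * norm (f o\<^sub>L T (t - \<tau>))"
            using norm_le_dual_norm[OF dual_of_diff_closed[OF qS[OF \<tau>'(1)] qS[OF x]] gS] by simp
          also have "\<dots> \<le> (e / M) * (M * norm f)"
            using e M(1) qd[OF \<tau>'(1,2)] norm_adjoint_le[OF M(2)[OF \<tau>'(4)], of f] by (intro mult_mono) auto
          finally show ?thesis using M(1) by simp
        qed
        then have "norm (integral {a..b} ?k) \<le> (e * norm f) * (b - a)"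
          using ab by (intro integral_bound kc) auto
        moreover have "integral {a..b} ?k = integral {a..b} (\<lambda>\<tau>. q \<tau> (f o\<^sub>L T (t - \<tau>))) - f (v - w)"
          using integral_diff[OF integrable_continuous_interval[OF cont[OF f ab(4,5)]] has_integral_integrable[OF x_int]]
            integral_unique[OF x_int] by simp
        ultimately show ?thesis by (simp add: norm_minus_commute mult_ac)
      qed
      then show ?thesis by blast
    qed
    then show ?case using d by blast
  qed
  then obtain v where v: "\<And>f. f \<in> S \<Longrightarrow> norm (blinfun_apply f v -
      integral {s..t} (\<lambda>\<tau>. q \<tau> (f o\<^sub>L T (t - \<tau>)))) \<le> e * (t - s) * norm f" by blast
  have "e * (t - s) * norm f \<le> e * norm f" for f :: "'a \<Rightarrow>\<^sub>L 'k"
    using st e by (intro mult_right_mono) auto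
  note le = order_trans[OF v this]
  show "\<exists>v. \<forall>f\<in>S. norm (blinfun_apply f v -
      integral {s..t} (\<lambda>\<tau>. q \<tau> (f o\<^sub>L T (t - \<tau>)))) \<le> e * norm f"
    by (intro exI[of _ v] ballI le)
qed

theorem admissible_range_iff:
  "admissible_range sc T M \<longleftrightarrow> closed_subspace_dual S M \<and> M \<subseteq> sun_cross sc T"
proof
  assume "admissible_range sc T M"
  then show "closed_subspace_dual S M \<and> M \<subseteq> sun_cross sc T"
    using admissible_range_subset_sun_cross by (auto simp: admissible_range_def)
next
  assume M: "closed_subspace_dual S M \<and> M \<subseteq> sun_cross sc T"
  have "is_interval {0..1::real}" by (rule is_interval_cc)
  moreover have "\<exists>a\<in>{0..1::real}. \<exists>b\<in>{0..1}. a < b"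
    by (rule bexI[of _ 0], rule bexI[of _ 1]) simp_all
  moreover have "weakstar_integral S s t (\<lambda>\<tau>. sun_star_semigroup sc T (t - \<tau>) (q \<tau>)) \<in> range (sun_embedding sc T)"
    if "(\<forall>t\<in>{0..1}. q t \<in> M) \<and> norm_continuous_on S {0..1} q" "s \<in> {0..1}" "t \<in> {0..1}" "s \<le> t" for q s t
    unfolding convolution_in_range_iff using that M by (intro sun_cross_convolution) auto
  ultimately show "admissible_range sc T M"
    unfolding admissible_range_def using M
    by (intro conjI exI[of _ "{0..1}"] allI impI ballI) simp_all
qed

end


section \<open>Resolvents\<close>

context c0_semigroup_on
begin

abbreviation A :: "('a \<times> 'a) set"
  where "A \<equiv> generator UNIV (\<lambda>t. blinfun_apply (T t))"

lemma scale_dual_compose: "scale_dual c f o\<^sub>L B = scale_dual c (f o\<^sub>L B)"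
  by (rule blinfun_eqI) simp

lemma sun_dual_scale: "f \<in> S \<Longrightarrow> scale_dual c f \<in> S"
proof -
  assume f: "f \<in> S"
  have "((\<lambda>t. blinfun_mult_right c o\<^sub>L (f o\<^sub>L T t)) \<longlongrightarrow> blinfun_mult_right c o\<^sub>L f) (at_right 0)"
    using f by (intro tendsto_intros) (simp add: in_sun_dual_iff)
  then show ?thesis using f
    by (simp add: in_sun_dual_iff dual_space_def scale_dual_compose mult_ac flip: scale_dual_def)
qed

lemma sun_dual_linear: "f \<in> S \<Longrightarrow> blinfun_apply f (sc c x) = c * f x"
  by (simp add: in_sun_dual_iff dual_of_scale)

lemma dual_of_scale_closed:
  assumes "\<phi> \<in> dual_of S"
  shows "scale_fun c \<phi> \<in> dual_of S"
proof -
  obtain C where C: "C \<ge> 0" "\<And>f. f \<in> S \<Longrightarrow> norm (\<phi> f) \<le> C * norm f" using star_bounded[OF assms] by blast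
  have "norm (c * \<phi> f) \<le> (norm c * C) * norm f" if "f \<in> S" for f
    using mult_left_mono[OF C(2)[OF that] norm_ge_zero[of c]] by (simp add: norm_mult mult_ac)
  then have "\<exists>C. \<forall>f\<in>S. norm (c * \<phi> f) \<le> C * norm f" by blast
  then show ?thesis using assms by (simp add: dual_of_def scale_fun_def distrib_left mult_ac)
qed

lemma sun_generator_iff:
  "(f, g) \<in> sun_generator sc T \<longleftrightarrow>
    f \<in> S \<and> g \<in> S \<and> ((\<lambda>h. ((f o\<^sub>L T h) - f) /\<^sub>R h) \<longlongrightarrow> g) (at_right 0)"
  by (simp add: sun_generator_def generator_def adjoint_semigroup_def)

text \<open>
  Both sides are limits of the same difference quotients.
\<close>

lemma sun_generator_dual_pairing:
  assumes "(f, g) \<in> sun_generator sc T" "(z, w) \<in> A"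
  shows "g z = f w"
proof (rule tendsto_unique[OF trivial_limit_at_right_real])
  have "((\<lambda>h. ((f o\<^sub>L T h) - f) /\<^sub>R h) \<longlongrightarrow> g) (at_right 0)"
    using assms(1) by (simp add: sun_generator_iff)
  then have "((\<lambda>h. blinfun_apply (((f o\<^sub>L T h) - f) /\<^sub>R h) z) \<longlongrightarrow> g z) (at_right 0)"
    by (intro tendsto_intros)
  then show "((\<lambda>h. f ((T h z - z) /\<^sub>R h)) \<longlongrightarrow> g z) (at_right 0)"
    by (simp add: blinfun.diff_left blinfun.scaleR_left blinfun.diff_right blinfun.scaleR_right)
  have "((\<lambda>h. (T h z - z) /\<^sub>R h) \<longlongrightarrow> w) (at_right 0)"
    using assms(2) by (simp add: generator_def)
  then show "((\<lambda>h. f ((T h z - z) /\<^sub>R h)) \<longlongrightarrow> f w) (at_right 0)" by (intro tendsto_intros)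
qed

lemma generator_scale:
  assumes "(z, w) \<in> A"
  shows "(sc c z, sc c w) \<in> A"
proof -
  have "((\<lambda>h. sc c ((T h z - z) /\<^sub>R h)) \<longlongrightarrow> sc c w) (at_right 0)"
    using assms by (intro bounded_linear.tendsto[OF bounded_linear_scale]) (simp add: generator_def)
  then have "((\<lambda>h. (T h (sc c z) - sc c z) /\<^sub>R h) \<longlongrightarrow> sc c w) (at_right 0)"
    by (rule Lim_transform_eventually)
      (use eventually_at_right_less in \<open>eventually_elim,
        simp add: T_scale scale_right_diff_distrib linear_scale[OF bounded_linear.linear[OF bounded_linear_scale]]\<close>)
  then show ?thesis by (simp add: generator_def)
qed

lemma generator_T:
  assumes zw: "(z, w) \<in> A" and t: "t \<ge> 0"
  shows "(T t z, T t w) \<in> A"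
proof -
  have "((\<lambda>h. T t ((T h z - z) /\<^sub>R h)) \<longlongrightarrow> T t w) (at_right 0)"
    using zw by (intro tendsto_intros) (simp add: generator_def)
  then have "((\<lambda>h. (T h (T t z) - T t z) /\<^sub>R h) \<longlongrightarrow> T t w) (at_right 0)"
  proof (rule Lim_transform_eventually)
    show "\<forall>\<^sub>F h in at_right 0. T t ((T h z - z) /\<^sub>R h) = (T h (T t z) - T t z) /\<^sub>R h"
      using eventually_at_right_less
    proof eventually_elim
      case (elim h)
      then have "T t (T h z) = T h (T t z)" using T_add[of t h z] T_add[of h t z] t by (simp add: add.commute)
      then show ?case by (simp add: blinfun.scaleR_right blinfun.diff_right)
    qed
  qed
  then show ?thesis by (simp add: generator_def)
qed

context
  fixes \<mu> :: 'k
  assumes \<mu>: "\<mu> \<in> resolvent_set sc A"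
begin

definition R :: "'a \<Rightarrow>\<^sub>L 'a"
  where "R = Blinfun (resolvent sc \<mu> A)"

lemma R_eqI: "(z, w) \<in> A \<Longrightarrow> R (sc \<mu> z - w) = z"
  and R_in_generator: "(R x, sc \<mu> (R x) - x) \<in> A"
proof -
  have bl: "bounded_linear (resolvent sc \<mu> A)"
    and ex1: "\<And>y. \<exists>!x. \<exists>z. (x, z) \<in> A \<and> sc \<mu> x - z = y"
    using \<mu> by (auto simp: resolvent_set_def)
  have app: "R y = resolvent sc \<mu> A y" for y
    unfolding R_def by (simp add: bounded_linear_Blinfun_apply[OF bl])
  show "R (sc \<mu> z - w) = z" if "(z, w) \<in> A"
    unfolding app resolvent_def using that by (intro the1_equality ex1) auto
  obtain z where "(R x, z) \<in> A" "sc \<mu> (R x) - z = x"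
    using theI'[OF ex1[of x]] unfolding app resolvent_def by blast
  then show "(R x, sc \<mu> (R x) - x) \<in> A" by (metis diff_diff_eq2 add_diff_cancel_left')
qed

lemma R_scale: "R (sc c x) = sc c (R x)"
proof -
  have "R (sc \<mu> (sc c (R x)) - sc c (sc \<mu> (R x) - x)) = sc c (R x)"
    by (rule R_eqI, rule generator_scale, rule R_in_generator)
  then show ?thesis by (simp add: scale_right_diff_distrib mult.commute)
qed

lemma R_T:
  assumes "t \<ge> 0"
  shows "R (T t x) = T t (R x)"
proof -
  have "R (sc \<mu> (T t (R x)) - T t (sc \<mu> (R x) - x)) = T t (R x)"
    by (rule R_eqI, rule generator_T, rule R_in_generator) (rule assms)
  then show ?thesis using assms by (simp add: blinfun.diff_right T_scale)
qed

text \<open>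
  The adjoint of the resolvent is the resolvent of the sun generator at the same point. The operator
  \<open>B\<close> in the proof maps \<open>x\<close> to the generator applied to \<open>R x\<close>.
\<close>

lemma adjoint_R_in_sun_generator:
  assumes f: "f \<in> S"
  shows "(f o\<^sub>L R, scale_dual \<mu> (f o\<^sub>L R) - f) \<in> sun_generator sc T"
proof -
  define B where "B = Blinfun (\<lambda>x. sc \<mu> (R x) - x)"
  have "bounded_linear (\<lambda>x. sc \<mu> (R x) - x)"
    by (intro bounded_linear_intros bounded_linear_compose[OF bounded_linear_scale])
  then have B: "B x = sc \<mu> (R x) - x" for x by (simp add: B_def bounded_linear_Blinfun_apply)
  have fB: "f o\<^sub>L B = scale_dual \<mu> (f o\<^sub>L R) - f"
    by (rule blinfun_eqI) (simp add: B blinfun.diff_right blinfun.diff_left sun_dual_linear[OF f])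
  have eq: "((f o\<^sub>L R) o\<^sub>L T h) - (f o\<^sub>L R) = (f o\<^sub>L orbit_integral h) o\<^sub>L B" if "h \<ge> 0" for h
  proof (rule blinfun_eqI)
    fix x
    have "orbit_integral h (B x) = T h (R x) - R x"
      unfolding B by (rule generator_integral[OF R_in_generator that])
    then show "blinfun_apply (((f o\<^sub>L R) o\<^sub>L T h) - (f o\<^sub>L R)) x
        = blinfun_apply ((f o\<^sub>L orbit_integral h) o\<^sub>L B) x"
      by (simp add: blinfun.diff_left R_T[OF that] blinfun.diff_right)
  qed
  have "((\<lambda>h. ((f o\<^sub>L orbit_integral h) /\<^sub>R h) o\<^sub>L B) \<longlongrightarrow> f o\<^sub>L B) (at_right 0)"
    by (intro tendsto_intros adjoint_orbit_integral_average f)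
  then have lim: "((\<lambda>h. (((f o\<^sub>L R) o\<^sub>L T h) - (f o\<^sub>L R)) /\<^sub>R h) \<longlongrightarrow> f o\<^sub>L B) (at_right 0)"
    by (rule Lim_transform_eventually)
      (use eventually_at_right_less in \<open>eventually_elim,
        simp add: eq bounded_bilinear.scaleR_left[OF bounded_bilinear_blinfun_compose]\<close>)
  have "((\<lambda>h. h *\<^sub>R ((((f o\<^sub>L R) o\<^sub>L T h) - (f o\<^sub>L R)) /\<^sub>R h) + (f o\<^sub>L R)) \<longlongrightarrow> 0 *\<^sub>R (f o\<^sub>L B) + (f o\<^sub>L R)) (at_right 0)"
    by (intro tendsto_intros lim)
  then have "((\<lambda>h. (f o\<^sub>L R) o\<^sub>L T h) \<longlongrightarrow> 0 *\<^sub>R (f o\<^sub>L B) + (f o\<^sub>L R)) (at_right 0)"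
    by (rule Lim_transform_eventually) (use eventually_at_right_less in \<open>eventually_elim, simp\<close>)
  then have "f o\<^sub>L R \<in> S"
    using f by (simp add: in_sun_dual_iff dual_space_def R_scale)
  moreover from this have "scale_dual \<mu> (f o\<^sub>L R) - f \<in> S" by (intro sun_dual_diff sun_dual_scale f)
  ultimately show ?thesis using lim fB by (simp add: sun_generator_iff)
qed

lemma adjoint_R_in_sun_dual: "f \<in> S \<Longrightarrow> f o\<^sub>L R \<in> S"
  using adjoint_R_in_sun_generator sun_generator_iff by blast

text \<open>
  Existence and uniqueness are both needed here, since the resolvent is a definite description, and
  both follow from the two preceding descriptions of the adjoint of \<open>R\<close>.
\<close>

lemma resolvent_sun_star:
  assumes \<phi>: "\<phi> \<in> dual_of S"
  shows "resolvent scale_fun \<mu> (sun_star_generator sc T) \<phi> = (\<lambda>f. if f \<in> S then \<phi> (f o\<^sub>L R) else 0)"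
proof -
  let ?\<eta> = "\<lambda>f. if f \<in> S then \<phi> (f o\<^sub>L R) else 0"
  have \<eta>: "?\<eta> \<in> dual_of S"
  proof -
    obtain C where C: "C \<ge> 0" "\<And>f. f \<in> S \<Longrightarrow> norm (\<phi> f) \<le> C * norm f" using star_bounded[OF \<phi>] by blast
    have "norm (?\<eta> f) \<le> (C * norm R) * norm f" if f: "f \<in> S" for f
      using order_trans[OF C(2)[OF adjoint_R_in_sun_dual[OF f]] mult_left_mono[OF norm_blinfun_compose C(1)]] f
      by (simp add: mult_ac)
    then have "\<exists>C. \<forall>f\<in>S. norm (?\<eta> f) \<le> C * norm f" by blast
    moreover have "(f + g) o\<^sub>L R = (f o\<^sub>L R) + (g o\<^sub>L R)" for f g :: "'a \<Rightarrow>\<^sub>L 'k"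
      by (rule bounded_bilinear.add_left[OF bounded_bilinear_blinfun_compose])
    moreover have "\<phi> (scale_dual c f) = c * \<phi> f" if "f \<in> S" for c f
      using \<phi> that by (simp add: dual_of_def)
    ultimately show ?thesis
      using star_add[OF \<phi>] by (simp add: dual_of_def sun_dual_add sun_dual_scale
          scale_dual_compose adjoint_R_in_sun_dual)
  qed
  show ?thesis
    unfolding resolvent_def
  proof (rule the_equality)
    have "(?\<eta>, scale_fun \<mu> ?\<eta> - \<phi>) \<in> sun_star_generator sc T"
    proof -
      have eq: "(scale_fun \<mu> ?\<eta> - \<phi>) f = ?\<eta> g" if fg: "(f, g) \<in> sun_generator sc T" for f g
      proof -
        have S: "f \<in> S" "g \<in> S" using fg by (auto simp: sun_generator_iff)
        have "g o\<^sub>L R = scale_dual \<mu> (f o\<^sub>L R) - f"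
          using sun_generator_dual_pairing[OF fg R_in_generator]
          by (intro blinfun_eqI) (simp add: blinfun.diff_right blinfun.diff_left sun_dual_linear[OF S(1)])
        moreover have "\<phi> (scale_dual \<mu> (f o\<^sub>L R)) = \<mu> * \<phi> (f o\<^sub>L R)"
          using \<phi> adjoint_R_in_sun_dual[OF S(1)] by (simp add: dual_of_def)
        ultimately show ?thesis
          using S star_diff[OF \<phi> sun_dual_scale[OF adjoint_R_in_sun_dual[OF S(1)]] S(1), of \<mu>]
          by (simp add: scale_fun_def)
      qed
      show ?thesis
        unfolding sun_star_generator_def adjoint_graph_def mem_Collect_eq prod.case
        by (simp only: Ball_def split_paired_All prod.case)
          (intro conjI allI impI eq dual_of_diff_closed dual_of_scale_closed \<eta> \<phi>)
    qed
    then show "\<exists>z. (?\<eta>, z) \<in> sun_star_generator sc T \<and> scale_fun \<mu> ?\<eta> - z = \<phi>"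
      by (intro exI[of _ "scale_fun \<mu> ?\<eta> - \<phi>"]) simp
  next
    fix \<eta> assume "\<exists>\<psi>. (\<eta>, \<psi>) \<in> sun_star_generator sc T \<and> scale_fun \<mu> \<eta> - \<psi> = \<phi>"
    then obtain \<psi> where \<psi>: "(\<eta>, \<psi>) \<in> sun_star_generator sc T" "\<phi> = scale_fun \<mu> \<eta> - \<psi>" by blast
    have \<eta>S: "\<eta> \<in> dual_of S" using \<psi>(1) by (simp add: sun_star_generator_def adjoint_graph_def)
    show "\<eta> = ?\<eta>"
    proof
      fix f
      show "\<eta> f = ?\<eta> f"
      proof (cases "f \<in> S")
        case True
        note fR = adjoint_R_in_sun_dual[OF True]
        have "\<psi> (f o\<^sub>L R) = \<eta> (scale_dual \<mu> (f o\<^sub>L R) - f)"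
          using \<psi>(1) adjoint_R_in_sun_generator[OF True]
          by (auto simp: sun_star_generator_def adjoint_graph_def)
        also have "\<dots> = \<mu> * \<eta> (f o\<^sub>L R) - \<eta> f"
          using star_diff[OF \<eta>S sun_dual_scale[OF fR] True] \<eta>S fR by (simp add: dual_of_def)
        finally show ?thesis using True by (simp add: \<psi>(2) scale_fun_def)
      next
        case False
        then show ?thesis using \<eta>S by (simp add: dual_of_def)
      qed
    qed
  qed
qed

lemma sun_times_iff:
  "\<phi> \<in> sun_times sc T \<mu> \<longleftrightarrow>
    \<phi> \<in> dual_of S \<and> (\<exists>x. \<forall>f\<in>S. blinfun_apply f x = \<phi> (f o\<^sub>L R))"
proof -
  have "(\<lambda>f. if f \<in> S then \<phi> (f o\<^sub>L R) else 0) = sun_embedding sc T x \<longleftrightarrow>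
      (\<forall>f\<in>S. blinfun_apply f x = \<phi> (f o\<^sub>L R))" for x
    unfolding sun_embedding_def fun_eq_iff Ball_def by (rule all_cong1) auto
  then show ?thesis
    unfolding sun_times_def sun_star_dual_def mem_Collect_eq image_iff
    by (simp add: resolvent_sun_star cong: conj_cong)
qed

text \<open>
  If \<open>x\<close> represents the resolvent of \<open>\<phi>\<close>, integrating the resolvent equation shows that
  \<open>\<mu> I x - T t x + x\<close> represents the integral of the orbit of \<open>\<phi>\<close>, where \<open>I\<close> is integration of orbits over \<open>{0..t}\<close>.
  Conversely, if \<open>\<phi> = j y - \<psi>\<close> with the weak-star derivative \<open>\<psi>\<close> of the orbit of \<open>x\<close>, then
  \<open>R y - \<mu> R x + x\<close> represents the resolvent of \<open>\<phi>\<close>.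
\<close>

theorem sun_times_eq_sun_cross: "sun_times sc T \<mu> = sun_cross sc T"
proof (intro set_eqI iffI)
  fix \<phi> assume "\<phi> \<in> sun_times sc T \<mu>"
  then obtain x where \<phi>: "\<phi> \<in> dual_of S" and x: "\<And>f. f \<in> S \<Longrightarrow> blinfun_apply f x = \<phi> (f o\<^sub>L R)"
    unfolding sun_times_iff by blast
  show "\<phi> \<in> sun_cross sc T"
  proof (rule sun_crossI[OF \<phi> zero_less_one])
    fix t :: real assume t: "t \<in> {0..1}"
    have "f (sc \<mu> (orbit_integral t x) - T t x + x) = \<phi> (f o\<^sub>L orbit_integral t)" if f: "f \<in> S" for f
    proof -
      let ?k = "scale_dual \<mu> (f o\<^sub>L orbit_integral t) - (f o\<^sub>L T t) + f"
      have fI: "f o\<^sub>L orbit_integral t \<in> S"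
        using f t sun_dual_orbit_integral[of f t] by (simp add: in_sun_dual_iff)
      have kS: "?k \<in> S" using t by (intro sun_dual_add sun_dual_diff sun_dual_scale sun_dual_T f fI) auto
      have "?k o\<^sub>L R = f o\<^sub>L orbit_integral t"
      proof (rule blinfun_eqI)
        fix z
        have "orbit_integral t (sc \<mu> (R z) - z) = T t (R z) - R z"
          using t by (intro generator_integral R_in_generator) auto
        then have "f (orbit_integral t (sc \<mu> (R z) - z)) = f (T t (R z) - R z)" by simp
        then show "blinfun_apply (?k o\<^sub>L R) z = blinfun_apply (f o\<^sub>L orbit_integral t) z"
          using t by (simp add: blinfun.add_left blinfun.diff_left blinfun.diff_right orbit_integral_scale
              sun_dual_linear[OF f] algebra_simps)
      qed
      then have "\<phi> (f o\<^sub>L orbit_integral t) = ?k x" using x[OF kS] by simp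
      also have "\<dots> = f (sc \<mu> (orbit_integral t x) - T t x + x)"
        by (simp add: blinfun.add_left blinfun.diff_left blinfun.add_right blinfun.diff_right sun_dual_linear[OF f])
      finally show ?thesis by simp
    qed
    then show "\<exists>v. \<forall>f\<in>S. blinfun_apply f v = \<phi> (f o\<^sub>L orbit_integral t)" by blast
  qed
next
  fix \<phi> assume "\<phi> \<in> sun_cross sc T"
  then obtain x y where \<phi>: "\<phi> \<in> dual_of S"
    and xy: "weakstar_derivative sc T x (\<lambda>f. blinfun_apply f y - \<phi> f)"
    by (auto simp: sun_cross_def sun_star_dual_def)
  have "f (R y - sc \<mu> (R x) + x) = \<phi> (f o\<^sub>L R)" if f: "f \<in> S" for f
  proof -
    let ?g = "scale_dual \<mu> (f o\<^sub>L R) - f"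
    have "((\<lambda>h. (((f o\<^sub>L R) o\<^sub>L T h) - (f o\<^sub>L R)) /\<^sub>R h) \<longlongrightarrow> ?g) (at_right 0)"
      using adjoint_R_in_sun_generator[OF f] by (simp add: sun_generator_iff)
    then have "((\<lambda>h. blinfun_apply ((((f o\<^sub>L R) o\<^sub>L T h) - (f o\<^sub>L R)) /\<^sub>R h) x) \<longlongrightarrow> ?g x) (at_right 0)"
      by (intro tendsto_intros)
    then have "((\<lambda>h. ((f o\<^sub>L R) (T h x) - (f o\<^sub>L R) x) /\<^sub>R h) \<longlongrightarrow> ?g x) (at_right 0)"
      by (simp add: blinfun.diff_left blinfun.scaleR_left)
    moreover have "((\<lambda>h. ((f o\<^sub>L R) (T h x) - (f o\<^sub>L R) x) /\<^sub>R h) \<longlongrightarrow> (f o\<^sub>L R) y - \<phi> (f o\<^sub>L R)) (at_right 0)"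
      using xy adjoint_R_in_sun_dual[OF f] unfolding weakstar_derivative_def by blast
    ultimately have "?g x = (f o\<^sub>L R) y - \<phi> (f o\<^sub>L R)"
      by (rule tendsto_unique[OF trivial_limit_at_right_real])
    then show ?thesis
      by (simp add: blinfun.add_right blinfun.diff_right blinfun.diff_left sun_dual_linear[OF f] algebra_simps)
  qed
  then show "\<phi> \<in> sun_times sc T \<mu>" using \<phi> unfolding sun_times_iff by blast
qed

end

end


section \<open>Perturbation\<close>

text \<open>
  If \<open>\<phi> = j y - \<psi>\<close> for \<open>T0\<close> with the vector \<open>x\<close>, then the same \<open>x\<close> and \<open>y\<close> represent \<open>\<phi> - L x\<close> for \<open>T\<close>,
  and \<open>L x\<close> is itself in the set. The hypotheses do not refer to an integral equation, so that the
  lemma applies in both directions, with \<open>- L\<close> for the way back.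
\<close>

lemma sun_cross_subset_perturbed:
  assumes "c0_semigroup_on sc T" and S: "sun_dual sc T0 = sun_dual sc T"
    and D: "\<And>x f. f \<in> sun_dual sc T \<Longrightarrow>
      ((\<lambda>h. (blinfun_apply f (T h x) - f (T0 h x)) /\<^sub>R h) \<longlongrightarrow> L x f) (at_right 0)"
    and L: "\<And>x. L x \<in> sun_cross sc T"
  shows "sun_cross sc T0 \<subseteq> sun_cross sc T"
proof
  interpret c0_semigroup_on sc T by fact
  fix \<phi> assume "\<phi> \<in> sun_cross sc T0"
  then obtain x y where \<phi>: "\<phi> \<in> dual_of S"
    and xy: "\<And>f. f \<in> S \<Longrightarrow> ((\<lambda>h. (blinfun_apply f (T0 h x) - f x) /\<^sub>R h) \<longlongrightarrow> f y - \<phi> f) (at_right 0)"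
    by (auto simp: sun_cross_def sun_star_dual_def weakstar_derivative_def S)
  have Lx: "L x \<in> dual_of S" using L[of x] by (simp add: sun_cross_def sun_star_dual_def)
  have "((\<lambda>h. (blinfun_apply f (T h x) - f x) /\<^sub>R h) \<longlongrightarrow> f y - (\<phi> - L x) f) (at_right 0)"
    if "f \<in> S" for f
    using tendsto_add[OF D[OF that, of x] xy[OF that]] by (simp add: algebra_simps)
  then have "\<phi> - L x \<in> sun_cross sc T"
    using dual_of_diff_closed[OF \<phi> Lx]
    by (auto simp: sun_cross_def sun_star_dual_def weakstar_derivative_def)
  from sun_cross_add[OF this L[of x]] show "\<phi> \<in> sun_cross sc T" by simp
qed

locale perturbation = T0: c0_semigroup_on sc T0
  for sc :: "'k::{real_normed_field,euclidean_space} \<Rightarrow> 'a::banach \<Rightarrow> 'a" and T0 +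
  fixes T :: "real \<Rightarrow> 'a \<Rightarrow>\<^sub>L 'a"
    and X0 :: "(('a \<Rightarrow>\<^sub>L 'k) \<Rightarrow> 'k) set"
    and L :: "'a \<Rightarrow> ('a \<Rightarrow>\<^sub>L 'k) \<Rightarrow> 'k"
  assumes adm: "admissible_range sc T0 X0"
    and bounded_L: "bounded_linear_sun_star sc T0 L"
    and range_L: "range L \<subseteq> X0"
    and pert: "perturbed_semigroup sc T0 L T"
begin

sublocale T: c0_semigroup_on sc T
  using pert by unfold_locales (simp add: perturbed_semigroup_def)

lemma L_dual: "L x \<in> dual_of T0.S"
  using bounded_L by (auto simp: bounded_linear_sun_star_def sun_star_dual_def)

lemma L_diff: "L (x - y) = L x - L y"
proof -
  have "L ((x - y) + y) = L (x - y) + L y"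
    using bounded_L by (simp only: bounded_linear_sun_star_def)
  then show ?thesis by simp
qed

lemma L_bounded: "\<exists>C\<ge>0. \<forall>x. dual_norm T0.S (L x) \<le> C * norm x"
proof -
  obtain C where C: "\<And>x. dual_norm T0.S (L x) \<le> C * norm x"
    using bounded_L by (auto simp: bounded_linear_sun_star_def)
  have "dual_norm T0.S (L x) \<le> \<bar>C\<bar> * norm x" for x
    by (rule order_trans[OF C]) (simp add: mult_right_mono)
  then show ?thesis by (intro exI[of _ "\<bar>C\<bar>"]) auto
qed

lemma norm_L_le:
  assumes C: "\<And>x. dual_norm T0.S (L x) \<le> C * norm x" and f: "f \<in> T0.S"
  shows "norm (L x f) \<le> C * norm x * norm f"
  by (rule order_trans[OF T0.norm_le_dual_norm[OF L_dual f]]) (intro mult_right_mono C, simp)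

lemma L_norm_continuous:
  assumes "continuous_on J u"
  shows "norm_continuous_on T0.S J (\<lambda>t. L (u t))"
  unfolding norm_continuous_on_def
proof
  fix t assume t: "t \<in> J"
  obtain C where C: "\<And>x. dual_norm T0.S (L x) \<le> C * norm x" using L_bounded by blast
  show "((\<lambda>s. dual_norm T0.S (L (u s) - L (u t))) \<longlongrightarrow> 0) (at t within J)"
  proof (rule Lim_null_comparison)
    show "\<forall>\<^sub>F s in at t within J. norm (dual_norm T0.S (L (u s) - L (u t))) \<le> C * norm (u s - u t)"
      using C T0.dual_norm_nonneg[OF L_dual] by (simp flip: L_diff)
    have "(u \<longlongrightarrow> u t) (at t within J)" using assms t by (simp add: continuous_on_def)
    then show "((\<lambda>s. C * norm (u s - u t)) \<longlongrightarrow> 0) (at t within J)"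
      by (intro tendsto_mult_right_zero tendsto_norm_zero LIM_zero)
  qed
qed

lemma duhamel_integrand_continuous:
  "f \<in> T0.S \<Longrightarrow> continuous_on {0..t} (\<lambda>\<tau>. L (T \<tau> x) (f o\<^sub>L T0 (t - \<tau>)))"
  by (intro T0.star_pairing_continuous L_norm_continuous T.orbit_continuous_on L_dual
      T0.adjoint_convolution_continuous_on T0.sun_dual_T) auto

text \<open>
  The interval of the admissibility hypothesis is arbitrary, and it yields the equation for
  times up to its length. The vector chosen by the inverse of the embedding matters only
  through its pairings with the sun dual.
\<close>

lemma duhamel:
  "\<exists>d>0. \<forall>t\<in>{0..d}. \<forall>x. \<forall>f\<in>T0.S.
    blinfun_apply f (T t x) - f (T0 t x) = integral {0..t} (\<lambda>\<tau>. L (T \<tau> x) (f o\<^sub>L T0 (t - \<tau>)))"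
proof -
  obtain J a b where J: "is_interval J" "a \<in> J" "b \<in> J" "a < b"
    and JX: "\<And>q. (\<forall>t\<in>J. q t \<in> X0) \<and> norm_continuous_on T0.S J q \<Longrightarrow> \<forall>s\<in>J. \<forall>t\<in>J. s \<le> t \<longrightarrow>
          weakstar_integral T0.S s t (\<lambda>\<tau>. sun_star_semigroup sc T0 (t - \<tau>) (q \<tau>)) \<in> range (sun_embedding sc T0)"
    using adm unfolding admissible_range_def by blast
  have "blinfun_apply f (T t x) - f (T0 t x) = integral {0..t} (\<lambda>\<tau>. L (T \<tau> x) (f o\<^sub>L T0 (t - \<tau>)))"
    if t: "t \<in> {0..b - a}" and f: "f \<in> T0.S" for t x f
  proof -
    \<comment> \<open>The maximum continues the function to the part of the interval to the left of \<open>a\<close>,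
      where \<open>T\<close> would have a negative argument.\<close>
    let ?q = "\<lambda>\<tau>. L (T (max 0 (\<tau> - a)) x)"
    let ?w = "weakstar_integral T0.S 0 t (\<lambda>\<tau>. sun_star_semigroup sc T0 (t - \<tau>) (L (T \<tau> x)))"
    have atJ: "a + t \<in> J" using t J(1,2,3) mem_is_interval_1_I[of J a b "a + t"] by simp
    have "continuous_on J (\<lambda>\<tau>. T (max 0 (\<tau> - a)) x)"
      by (rule continuous_on_compose2[OF T.orbit_continuous]) (auto intro!: continuous_intros)
    then have "(\<forall>t\<in>J. ?q t \<in> X0) \<and> norm_continuous_on T0.S J ?q"
      by (intro conjI ballI subsetD[OF range_L] rangeI L_norm_continuous)
    from JX[OF this, THEN bspec, OF J(2), THEN bspec, OF atJ, THEN mp]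
    obtain v where v: "\<And>f. f \<in> T0.S \<Longrightarrow>
        blinfun_apply f v = integral {a..a + t} (\<lambda>\<tau>. ?q \<tau> (f o\<^sub>L T0 (a + t - \<tau>)))"
      unfolding T0.convolution_in_range_iff using t by auto
    have v': "blinfun_apply f v = integral {0..t} (\<lambda>\<tau>. L (T \<tau> x) (f o\<^sub>L T0 (t - \<tau>)))" if "f \<in> T0.S" for f
    proof -
      have "blinfun_apply f v = integral {0..t} (\<lambda>\<tau>. ?q (a + \<tau>) (f o\<^sub>L T0 (a + t - (a + \<tau>))))"
        using v[OF that] integral_shift_Icc_real[of 0 t "\<lambda>\<tau>. ?q \<tau> (f o\<^sub>L T0 (a + t - \<tau>))" a]
        by (simp add: o_def add.commute)
      also have "\<dots> = integral {0..t} (\<lambda>\<tau>. L (T \<tau> x) (f o\<^sub>L T0 (t - \<tau>)))"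
        by (rule integral_cong) (simp add: max_def)
      finally show ?thesis .
    qed
    then have "?w \<in> range (sun_embedding sc T0)" unfolding T0.convolution_in_range_iff by blast
    then have "sun_embedding sc T0 (inv (sun_embedding sc T0) ?w) = ?w" by (rule f_inv_into_f)
    then have "sun_embedding sc T0 (inv (sun_embedding sc T0) ?w) f = ?w f" by (rule fun_cong)
    then have "f (inv (sun_embedding sc T0) ?w) = integral {0..t} (\<lambda>\<tau>. L (T \<tau> x) (f o\<^sub>L T0 (t - \<tau>)))"
      using f by (simp add: sun_embedding_def weakstar_integral_def T0.sun_star_semigroup_apply)
    moreover have "T t x = T0 t x + inv (sun_embedding sc T0) ?w"
      using pert t unfolding perturbed_semigroup_def by simp
    ultimately show ?thesis by (simp add: blinfun.add_right)
  qed
  then show ?thesis using J(4) by (intro exI[of _ "b - a"]) auto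
qed

text \<open>
  Pairing with the sun dual of \<open>T0\<close> bounds the difference, because that space norms \<open>X\<close>.
\<close>

lemma perturbation_small: "\<exists>d>0. \<exists>c. \<forall>t\<in>{0..d}. norm (T t - T0 t) \<le> c * t"
proof -
  obtain d where d: "d > 0" and duh: "\<And>t x f. t \<in> {0..d} \<Longrightarrow> f \<in> T0.S \<Longrightarrow>
    blinfun_apply f (T t x) - f (T0 t x) = integral {0..t} (\<lambda>\<tau>. L (T \<tau> x) (f o\<^sub>L T0 (t - \<tau>)))"
    using duhamel by blast
  obtain C where C: "C \<ge> 0" "\<And>x. dual_norm T0.S (L x) \<le> C * norm x" using L_bounded by blast
  obtain M0 where M0: "M0 \<ge> 1" "\<And>s. s \<in> {0..d} \<Longrightarrow> norm (T0 s) \<le> M0" using T0.T_bounded by blast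
  obtain M where M: "M \<ge> 1" "\<And>s. s \<in> {0..d} \<Longrightarrow> norm (T s) \<le> M" using T.T_bounded by blast
  obtain K where K: "K > 0" "\<And>x B. B \<ge> 0 \<Longrightarrow> (\<And>f. f \<in> T0.S \<Longrightarrow> norm (blinfun_apply f x) \<le> B * norm f) \<Longrightarrow> norm x \<le> K * B"
    using T0.sun_dual_norming by blast
  have "norm (T t - T0 t) \<le> (K * (C * M * M0)) * t" if t: "t \<in> {0..d}" for t
  proof (rule norm_blinfun_bound)
    show "0 \<le> (K * (C * M * M0)) * t" using K(1) C(1) M(1) M0(1) t by simp
    fix x
    have "norm (T t x - T0 t x) \<le> K * (C * M * M0 * t * norm x)"
    proof (rule K(2))
      show "0 \<le> C * M * M0 * t * norm x" using C(1) M(1) M0(1) t by simp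
      fix f assume f: "f \<in> T0.S"
      have "norm (integral {0..t} (\<lambda>\<tau>. L (T \<tau> x) (f o\<^sub>L T0 (t - \<tau>))))
          \<le> (C * (M * norm x) * (M0 * norm f)) * (t - 0)"
      proof (rule integral_bound[OF _ duhamel_integrand_continuous[OF f]])
        fix \<tau> assume \<tau>: "\<tau> \<in> {0..t}"
        have "norm (L (T \<tau> x) (f o\<^sub>L T0 (t - \<tau>))) \<le> C * norm (T \<tau> x) * norm (f o\<^sub>L T0 (t - \<tau>))"
          using \<tau> by (intro norm_L_le[OF C(2)] T0.sun_dual_T f) auto
        also have "\<dots> \<le> C * (M * norm x) * (M0 * norm f)"
        proof (intro mult_mono mult_left_mono)
          show "norm (T \<tau> x) \<le> M * norm x"
            using order_trans[OF norm_blinfun mult_right_mono[OF M(2) norm_ge_zero]] \<tau> t by auto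
          show "norm (f o\<^sub>L T0 (t - \<tau>)) \<le> M0 * norm f"
            using \<tau> t by (intro T0.norm_adjoint_le M0) auto
        qed (use C(1) M(1) in auto)
        finally show "norm (L (T \<tau> x) (f o\<^sub>L T0 (t - \<tau>))) \<le> C * (M * norm x) * (M0 * norm f)" .
      qed (use t in auto)
      then show "norm (f (T t x - T0 t x)) \<le> C * M * M0 * t * norm x * norm f"
        using duh[OF t f] by (simp add: blinfun.diff_right mult_ac)
    qed
    then show "norm (blinfun_apply (T t - T0 t) x) \<le> (K * (C * M * M0)) * t * norm x"
      by (simp add: blinfun.diff_left mult_ac)
  qed
  then show ?thesis using d by blast
qed

lemma sun_dual_eq: "sun_dual sc T = sun_dual sc T0"
proof -
  obtain d c where d: "d > 0" and c: "\<And>t. t \<in> {0..d} \<Longrightarrow> norm (T t - T0 t) \<le> c * t"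
    using perturbation_small by blast
  have lim: "((\<lambda>t. (f o\<^sub>L T t) - (f o\<^sub>L T0 t)) \<longlongrightarrow> 0) (at_right 0)" for f :: "'a \<Rightarrow>\<^sub>L 'k"
  proof (rule Lim_null_comparison)
    show "\<forall>\<^sub>F t in at_right 0. norm ((f o\<^sub>L T t) - (f o\<^sub>L T0 t)) \<le> (c * t) * norm f"
      using eventually_at_right_real[OF d]
    proof eventually_elim
      case (elim t)
      have "(f o\<^sub>L T t) - (f o\<^sub>L T0 t) = f o\<^sub>L (T t - T0 t)"
        by (rule bounded_bilinear.diff_right[OF bounded_bilinear_blinfun_compose, symmetric])
      then show ?case using T0.norm_adjoint_le[OF c[of t], of f] elim by simp
    qed
    show "((\<lambda>t. (c * t) * norm f) \<longlongrightarrow> 0) (at_right 0)"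
      by (rule tendsto_eq_intros refl | simp)+
  qed
  have "((\<lambda>t. f o\<^sub>L T t) \<longlongrightarrow> f) (at_right 0) \<longleftrightarrow> ((\<lambda>t. f o\<^sub>L T0 t) \<longlongrightarrow> f) (at_right 0)" for f :: "'a \<Rightarrow>\<^sub>L 'k"
  proof
    assume "((\<lambda>t. f o\<^sub>L T t) \<longlongrightarrow> f) (at_right 0)"
    from tendsto_diff[OF this lim[of f]] show "((\<lambda>t. f o\<^sub>L T0 t) \<longlongrightarrow> f) (at_right 0)" by simp
  next
    assume "((\<lambda>t. f o\<^sub>L T0 t) \<longlongrightarrow> f) (at_right 0)"
    from tendsto_add[OF lim[of f] this] show "((\<lambda>t. f o\<^sub>L T t) \<longlongrightarrow> f) (at_right 0)" by simp
  qed
  then show ?thesis by (auto simp: T.in_sun_dual_iff T0.in_sun_dual_iff)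
qed

text \<open>
  Divided by \<open>h\<close>, the right-hand side of the integral equation is an average over a
  short interval on which the integrand is close to \<open>L x f\<close>: the first argument tends to \<open>x\<close> in norm and the functional to \<open>f\<close>
  in norm.
\<close>

lemma weakstar_derivative_difference:
  assumes f: "f \<in> T0.S"
  shows "((\<lambda>h. (blinfun_apply f (T h x) - f (T0 h x)) /\<^sub>R h) \<longlongrightarrow> L x f) (at_right 0)"
proof (rule tendstoI)
  fix e :: real assume e: "e > 0"
  obtain d where d: "d > 0" and duh: "\<And>t x f. t \<in> {0..d} \<Longrightarrow> f \<in> T0.S \<Longrightarrow>
    blinfun_apply f (T t x) - f (T0 t x) = integral {0..t} (\<lambda>\<tau>. L (T \<tau> x) (f o\<^sub>L T0 (t - \<tau>)))"
    using duhamel by blast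
  obtain C where C: "C \<ge> 0" "\<And>x. dual_norm T0.S (L x) \<le> C * norm x" using L_bounded by blast
  obtain M0 where M0: "M0 \<ge> 1" "\<And>s. s \<in> {0..d} \<Longrightarrow> norm (T0 s) \<le> M0" using T0.T_bounded by blast
  define r where "r = e / (2 * (C * M0 * norm f + C * norm x + 1))"
  have pos: "C * M0 * norm f + C * norm x + 1 > 0" using C(1) M0(1) by (simp add: add_nonneg_pos)
  have r: "r > 0" "(C * M0 * norm f + C * norm x) * r \<le> e / 2"
  proof -
    show "r > 0" unfolding r_def using e pos by simp
    then have "(C * M0 * norm f + C * norm x) * r \<le> (C * M0 * norm f + C * norm x + 1) * r"
      by (intro mult_right_mono) auto
    also have "\<dots> = e / 2" unfolding r_def using pos by (simp add: field_simps)
    finally show "(C * M0 * norm f + C * norm x) * r \<le> e / 2" .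
  qed
  obtain d1 where d1: "d1 > 0" "\<And>s. 0 < s \<Longrightarrow> s < d1 \<Longrightarrow> norm (T s x - x) < r"
    using tendstoD[OF T.T_tendsto[of x] r(1)] unfolding eventually_at_right_field dist_norm by auto
  have "((\<lambda>s. f o\<^sub>L T0 s) \<longlongrightarrow> f) (at_right 0)" using f by (simp add: T0.in_sun_dual_iff)
  from tendstoD[OF this r(1)]
  obtain d2 where d2: "d2 > 0" "\<And>s. 0 < s \<Longrightarrow> s < d2 \<Longrightarrow> norm ((f o\<^sub>L T0 s) - f) < r"
    unfolding eventually_at_right_field dist_norm by auto
  have fid: "f o\<^sub>L id_blinfun = f" by (rule blinfun_eqI) simp
  have "dist ((blinfun_apply f (T h x) - f (T0 h x)) /\<^sub>R h) (L x f) < e" if h: "0 < h" "h < min d (min d1 d2)" for h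
  proof -
    have "norm (integral {0..h} (\<lambda>\<tau>. L (T \<tau> x) (f o\<^sub>L T0 (h - \<tau>))) - (h - 0) *\<^sub>R L x f) \<le> (e / 2) * (h - 0)"
    proof (rule integral_average_bound[OF _ duhamel_integrand_continuous[OF f]])
      fix \<tau> assume \<tau>: "\<tau> \<in> {0..h}"
      let ?g = "f o\<^sub>L T0 (h - \<tau>)"
      have gS: "?g \<in> T0.S" using \<tau> by (intro T0.sun_dual_T f) auto
      have 1: "norm (T \<tau> x - x) \<le> r" using d1(2)[of \<tau>] \<tau> h r(1) by (cases "\<tau> = 0") auto
      have 2: "norm (?g - f) \<le> r" using d2(2)[of "h - \<tau>"] \<tau> h r(1) by (cases "\<tau> = h") (auto simp: fid)
      have 3: "norm ?g \<le> M0 * norm f" using \<tau> h by (intro T0.norm_adjoint_le M0) auto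
      have "L (T \<tau> x) ?g - L x f = L (T \<tau> x - x) ?g + L x (?g - f)"
        by (simp add: L_diff T0.star_diff[OF L_dual gS f])
      then have "norm (L (T \<tau> x) ?g - L x f) \<le> norm (L (T \<tau> x - x) ?g) + norm (L x (?g - f))"
        by (simp add: norm_triangle_ineq)
      also have "\<dots> \<le> C * norm (T \<tau> x - x) * norm ?g + C * norm x * norm (?g - f)"
        by (intro add_mono norm_L_le[OF C(2)] gS T0.sun_dual_diff f)
      also have "\<dots> \<le> C * r * (M0 * norm f) + C * norm x * r"
        using C(1) r(1) 1 2 3 by (intro add_mono mult_mono mult_left_mono) auto
      also have "\<dots> = (C * M0 * norm f + C * norm x) * r" by (simp add: algebra_simps)
      also have "\<dots> \<le> e / 2" by (rule r(2))
      finally show "norm (L (T \<tau> x) ?g - L x f) \<le> e / 2" .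
    qed (use h in simp)
    then have "norm ((blinfun_apply f (T h x) - f (T0 h x)) - h *\<^sub>R L x f) \<le> (e / 2) * h"
      using duh[OF _ f, of h x] h by simp
    moreover have "(blinfun_apply f (T h x) - f (T0 h x)) /\<^sub>R h - L x f
        = ((blinfun_apply f (T h x) - f (T0 h x)) - h *\<^sub>R L x f) /\<^sub>R h"
      using h by (simp add: scaleR_diff_right)
    ultimately have "dist ((blinfun_apply f (T h x) - f (T0 h x)) /\<^sub>R h) (L x f) \<le> e / 2"
      using h by (simp add: dist_norm divide_le_eq flip: divide_inverse_commute)
    then show ?thesis using e by simp
  qed
  moreover have "min d (min d1 d2) > 0" using d d1 d2 by simp
  ultimately show "\<forall>\<^sub>F h in at_right 0. dist ((blinfun_apply f (T h x) - f (T0 h x)) /\<^sub>R h) (L x f) < e"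
    unfolding eventually_at_right_field by blast
qed

lemma L_in_sun_cross_T0: "L x \<in> sun_cross sc T0"
  by (rule subsetD[OF T0.admissible_range_subset_sun_cross[OF adm] subsetD[OF range_L rangeI]])

text \<open>
  The orbit of \<open>z\<close> under \<open>T\<close> has the weak-star derivative \<open>j w + L z\<close>; the vector \<open>- z\<close> thus
  represents \<open>L z = j (- w) - (- j w - L z)\<close>.
\<close>

lemma L_generator_domain_in_sun_cross:
  assumes "(z, w) \<in> T0.A"
  shows "L z \<in> sun_cross sc T"
proof -
  have "((\<lambda>h. (blinfun_apply f (T h (- z)) - f (- z)) /\<^sub>R h) \<longlongrightarrow> f (- w) - L z f) (at_right 0)"
    if f: "f \<in> T0.S" for f
  proof -
    have "((\<lambda>h. f ((T0 h z - z) /\<^sub>R h)) \<longlongrightarrow> f w) (at_right 0)"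
      using assms by (intro tendsto_intros) (simp add: generator_def)
    from tendsto_minus[OF tendsto_add[OF weakstar_derivative_difference[OF f, of z] this]]
    show ?thesis
      by (simp add: blinfun.minus_right blinfun.diff_right blinfun.scaleR_right algebra_simps)
  qed
  then show ?thesis
    using L_dual unfolding sun_cross_def sun_star_dual_def weakstar_derivative_def sun_dual_eq by blast
qed

text \<open>
  Approximating \<open>z\<close> by averages of its orbit under \<open>T0\<close> reduces the claim to the domain of the generator. The
  limit is taken in the description by integrals, where only the norm of \<open>L\<close> enters.
\<close>

lemma L_in_sun_cross_T: "L z \<in> sun_cross sc T"
proof (rule T.sun_crossI)
  show "L z \<in> dual_of T.S" using L_dual by (simp add: sun_dual_eq)
  fix t :: real assume t: "t \<in> {0..1}"
  obtain C where C: "C \<ge> 0" "\<And>x. dual_norm T0.S (L x) \<le> C * norm x" using L_bounded by blast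
  obtain M where M: "M \<ge> 1" "\<And>s. s \<in> {0..1} \<Longrightarrow> norm (T s) \<le> M" using T.T_bounded by blast
  show "\<exists>v. \<forall>f\<in>T.S. blinfun_apply f v = L z (f o\<^sub>L T.orbit_integral t)"
  proof (rule T.embedding_range_closed)
    fix e :: real assume e: "e > 0"
    define r where "r = e / (C * M + 1)"
    have pos: "C * M + 1 > 0" using C(1) M(1) by (simp add: add_nonneg_pos)
    have r: "r > 0" using e pos by (simp add: r_def)
    obtain h where h: "h > 0" "norm (T0.orbit_integral h z /\<^sub>R h - z) < r"
      using eventually_happens[OF eventually_conj[OF eventually_at_right_less
            tendstoD[OF T0.orbit_integral_average[of z] r]]]
      by (auto simp: dist_norm)
    let ?z = "T0.orbit_integral h z /\<^sub>R h"
    have "(sc (of_real (inverse h)) (T0.orbit_integral h z), sc (of_real (inverse h)) (T0 h z - z)) \<in> T0.A"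
      using h(1) by (intro T0.generator_scale T0.orbit_integral_in_generator) simp
    then have "(?z, (T0 h z - z) /\<^sub>R h) \<in> T0.A" by (simp only: T0.scale_of_real)
    from T.sun_cross_integral[OF L_generator_domain_in_sun_cross[OF this], of t]
    obtain v where v: "\<And>f. f \<in> T.S \<Longrightarrow> blinfun_apply f v = L ?z (f o\<^sub>L T.orbit_integral t)"
      using t by auto
    have "norm (blinfun_apply f v - L z (f o\<^sub>L T.orbit_integral t)) \<le> e * norm f" if f: "f \<in> T.S" for f
    proof -
      have fI: "f o\<^sub>L T.orbit_integral t \<in> T0.S"
        using T.sun_dual_orbit_integral[of f t] f t by (simp add: T.in_sun_dual_iff flip: sun_dual_eq)
      have nI: "norm (T.orbit_integral t) \<le> M"
      proof -
        have "norm (T.orbit_integral t) \<le> M * t"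
          using t by (intro T.norm_orbit_integral[of 1] M(2)) auto
        also have "\<dots> \<le> M * 1" using M(1) t by (intro mult_left_mono) auto
        finally show ?thesis by simp
      qed
      have "norm (blinfun_apply f v - L z (f o\<^sub>L T.orbit_integral t)) = norm (L (?z - z) (f o\<^sub>L T.orbit_integral t))"
        by (simp add: v[OF f] L_diff)
      also have "\<dots> \<le> C * norm (?z - z) * norm (f o\<^sub>L T.orbit_integral t)"
        by (rule norm_L_le[OF C(2) fI])
      also have "\<dots> \<le> C * r * (M * norm f)"
        using C(1) h(2) r T.norm_adjoint_le[OF nI, of f] by (intro mult_mono mult_left_mono) auto
      also have "\<dots> = (C * M) * r * norm f" by simp
      also have "\<dots> \<le> (C * M + 1) * r * norm f" using r by (intro mult_right_mono) auto
      also have "\<dots> = e * norm f" using pos by (simp add: r_def)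
      finally show ?thesis .
    qed
    then show "\<exists>v. \<forall>f\<in>T.S. norm (blinfun_apply f v - L z (f o\<^sub>L T.orbit_integral t)) \<le> e * norm f" by blast
  qed
qed simp

theorem sun_cross_eq: "sun_cross sc T = sun_cross sc T0"
proof
  show "sun_cross sc T0 \<subseteq> sun_cross sc T"
    using T.c0_semigroup_on_axioms sun_dual_eq[symmetric] weakstar_derivative_difference L_in_sun_cross_T
    by (intro sun_cross_subset_perturbed[where L = L]) (auto simp: sun_dual_eq)
  show "sun_cross sc T \<subseteq> sun_cross sc T0"
  proof (rule sun_cross_subset_perturbed[where L = "\<lambda>x. - L x"])
    show "((\<lambda>h. (blinfun_apply f (T0 h x) - f (T h x)) /\<^sub>R h) \<longlongrightarrow> (- L x) f) (at_right 0)"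
      if "f \<in> sun_dual sc T0" for x f
      using tendsto_minus[OF weakstar_derivative_difference[OF that, of x]] by (simp add: algebra_simps)
    show "- L x \<in> sun_cross sc T0" for x
      using T0.sun_cross_diff[OF T0.sun_cross_diff[OF L_in_sun_cross_T0 L_in_sun_cross_T0] L_in_sun_cross_T0, of x x x]
      by simp
  qed (use T0.c0_semigroup_on_axioms sun_dual_eq in auto)
qed

end

theorem corollary23:
  fixes sc :: "'k::{real_normed_field,euclidean_space} \<Rightarrow> 'a::banach \<Rightarrow> 'a"
    and T0 T :: "real \<Rightarrow> 'a \<Rightarrow>\<^sub>L 'a"
    and X0 :: "(('a \<Rightarrow>\<^sub>L 'k) \<Rightarrow> 'k) set"
    and L :: "'a \<Rightarrow> ('a \<Rightarrow>\<^sub>L 'k) \<Rightarrow> 'k"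
  assumes "banach_space_over sc"
    and "c0_semigroup sc T0"
    and "admissible_range sc T0 X0"
    and "bounded_linear_sun_star sc T0 L"
    and "range L \<subseteq> X0"
    and "perturbed_semigroup sc T0 L T"
  shows "(\<forall>M. maximal_admissible_range sc T M \<longleftrightarrow> maximal_admissible_range sc T0 M) \<and>
    (\<forall>\<mu> \<in> resolvent_set sc (generator UNIV T).
     \<forall>\<nu> \<in> resolvent_set sc (generator UNIV T0).
       sun_times sc T \<mu> = sun_times sc T0 \<nu>)"
proof -
  interpret banach_space_over sc by fact
  interpret perturbation sc T0 T X0 L using assms by unfold_locales
  have "admissible_range sc T M \<longleftrightarrow> admissible_range sc T0 M" for M
    by (simp add: T.admissible_range_iff T0.admissible_range_iff sun_dual_eq sun_cross_eq)
  then show ?thesis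
    by (simp add: maximal_admissible_range_def T.sun_times_eq_sun_cross T0.sun_times_eq_sun_cross sun_cross_eq)
qed

end
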